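(* Let $(\phi_t)_{t\ge 0}$ be a non-elliptic semigroup in the unit disc $\mathbb D$ with Denjoy-Wolff point $\tau\in\partial\mathbb D$ and Koenigs function $h$, and let $\Omega:=h(\mathbb D)$. Then the following are equivalent: (1) $\lim_{t\to+\infty}\mathrm{Arg}(1-\overline\tau\phi_t(z))=\pi/2$ (respectively $=-\pi/2$) for some (and hence any) $z\in\mathbb D$ (and, in particular, $[0,+\infty)\ni t\mapsto\phi_t(z)$ converges tangentially to $\tau$ as $t\to+\infty$); (2) for some (and hence any) $p\in\Omega$, $\lim_{t\to+\infty}\frac{\delta^+_{\Omega,p}(t)}{\delta^-_{\Omega,p}(t)}=0$ (respectively $\lim_{t\to+\infty}\frac{\delta^+_{\Omega,p}(t)}{\delta^-_{\Omega,p}(t)}=+\infty$). Here "for some (and hence any)" means that the "for some" version and the "for any" version of each condition are equivalent.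
   Context: A semigroup in $\mathbb D$ is a family $(\phi_t)_{t\ge0}$ of holomorphic self-maps of the unit disc $\mathbb D$ with $\phi_0=\mathrm{id}$, $\phi_{t+s}=\phi_t\circ\phi_s$, and $t\mapsto\phi_t$ continuous for the topology of uniform convergence on compacta. It is non-elliptic with Denjoy-Wolff point $\tau\in\partial\mathbb D$ if $\phi_t\to\tau$ uniformly on compacta of $\mathbb D$ as $t\to+\infty$. A Koenigs function of a non-elliptic semigroup is a univalent function $h:\mathbb D\to\mathbb C$ such that $h(\phi_t(z))=h(z)+it$ for all $t\ge0$, $z\in\mathbb D$ (it exists and is unique up to an additive constant). Its image $\Omega=h(\mathbb D)$ is starlike at infinity, i.e. it is a simply connected domain $\Omega\subsetneq\mathbb C$ with $\Omega+it\subseteq\Omega$ for all $t\ge0$. The orbit of $z$ converges tangentially to $\tau$ if the cluster set of $\mathrm{Arg}(1-\overline\tau\phi_t(z))$ as $t\to+\infty$ is $\{\pi/2\}$ or $\{-\pi/2\}$. For $p\in\mathbb C$ and $t\ge0$: $$\delta^+_{\Omega,p}(t):=\min\{t,\ \inf\{|z-(p+it)|: z\in\partial\Omega,\ \mathrm{Re}\,z\ge\mathrm{Re}\,p\}\},$$ $$\delta^-_{\Omega,p}(t):=\min\{t,\ \inf\{|z-(p+it)|: z\in\partial\Omega,\ \mathrm{Re}\,z\le\mathrm{Re}\,p\}\},$$ with $\inf\emptyset=+\infty$. *)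

theory Defs
  imports "HOL-Complex_Analysis.Complex_Analysis"
begin

text \<open>
  A family \<open>\<phi>\<close> is only constrained for \<open>t \<ge> 0\<close> and on the unit disc; its values elsewhere are
  irrelevant.
\<close>

definition disc_semigroup :: "(real \<Rightarrow> complex \<Rightarrow> complex) \<Rightarrow> bool" where
  "disc_semigroup \<phi> \<longleftrightarrow>
     (\<forall>t\<ge>0. \<phi> t holomorphic_on ball 0 1 \<and> \<phi> t ` ball 0 1 \<subseteq> ball 0 1) \<and>
     (\<forall>z\<in>ball 0 1. \<phi> 0 z = z) \<and>
     (\<forall>s\<ge>0. \<forall>t\<ge>0. \<forall>z\<in>ball 0 1. \<phi> (t + s) z = \<phi> t (\<phi> s z)) \<and>
     (\<forall>K t\<^sub>0. compact K \<and> K \<subseteq> ball 0 1 \<and> t\<^sub>0 \<ge> 0 \<longrightarrow>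
        uniform_limit K \<phi> (\<phi> t\<^sub>0) (at t\<^sub>0 within {0..}))"

definition nonelliptic_with_DW_point :: "(real \<Rightarrow> complex \<Rightarrow> complex) \<Rightarrow> complex \<Rightarrow> bool" where
  "nonelliptic_with_DW_point \<phi> \<tau> \<longleftrightarrow>
     disc_semigroup \<phi> \<and> \<tau> \<in> sphere 0 1 \<and>
     (\<forall>K. compact K \<and> K \<subseteq> ball 0 1 \<longrightarrow> uniform_limit K \<phi> (\<lambda>_. \<tau>) at_top)"

definition koenigs_function :: "(real \<Rightarrow> complex \<Rightarrow> complex) \<Rightarrow> (complex \<Rightarrow> complex) \<Rightarrow> bool" where
  "koenigs_function \<phi> h \<longleftrightarrow>
     h holomorphic_on ball 0 1 \<and> inj_on h (ball 0 1) \<and>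
     (\<forall>t\<ge>0. \<forall>z\<in>ball 0 1. h (\<phi> t z) = h z + \<i> * of_real t)"

definition cluster_set_at_top :: "(real \<Rightarrow> real) \<Rightarrow> real set" where
  "cluster_set_at_top f =
     {l. \<exists>s :: nat \<Rightarrow> real. filterlim s at_top sequentially \<and> (\<lambda>n. f (s n)) \<longlonglongrightarrow> l}"

definition orbit_converges_tangentially ::
    "(real \<Rightarrow> complex \<Rightarrow> complex) \<Rightarrow> complex \<Rightarrow> complex \<Rightarrow> bool" where
  "orbit_converges_tangentially \<phi> \<tau> z \<longleftrightarrow>
     cluster_set_at_top (\<lambda>t. Arg (1 - cnj \<tau> * \<phi> t z)) \<in> {{pi / 2}, {- pi / 2}}"

text \<open>
  The infima are taken in the extended reals, where the infimum of the empty set is \<open>\<infinity>\<close>. For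
  \<open>t \<ge> 0\<close> the minimum with \<open>t\<close> is always finite, so \<^const>\<open>real_of_ereal\<close> loses nothing.
\<close>

definition delta_plus :: "complex set \<Rightarrow> complex \<Rightarrow> real \<Rightarrow> real" where
  "delta_plus \<Omega> p t = real_of_ereal (min (ereal t)
     (INF z\<in>{z \<in> frontier \<Omega>. Re z \<ge> Re p}. ereal (cmod (z - (p + \<i> * of_real t)))))"

definition delta_minus :: "complex set \<Rightarrow> complex \<Rightarrow> real \<Rightarrow> real" where
  "delta_minus \<Omega> p t = real_of_ereal (min (ereal t)
     (INF z\<in>{z \<in> frontier \<Omega>. Re z \<le> Re p}. ereal (cmod (z - (p + \<i> * of_real t)))))"

end

theory Submission
  imports Defs
begin

text \<open>
  In the right half-plane with \<open>\<tau>\<close> at \<open>\<infinity>\<close>, Julia's lemma says that the semigroup does not decrease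
  the real part. Hence the Koenigs function becomes a map \<open>f\<close> with \<open>Im f' \<ge> 0\<close>, and integrating
  along segments \<open>(f z - f a) / (z - a)\<close> lies in the closed upper half-plane for all \<open>z\<close> and \<open>a\<close>.
  If \<open>p = f 1\<close>, the part of the boundary facing \<open>Im z \<le> 0\<close> is therefore to the right of \<open>p\<close> or
  below it.

  Write \<open>E z = Re z * \<bar>f' z\<bar>\<close>, which is at most a constant times the distance from \<open>f z\<close> to the
  boundary. The mean value property for \<open>f' powr (3 / 4)\<close> yields a path from \<open>z\<close> to the boundary
  which never moves upwards and whose image has length \<open>O(E z)\<close>. So from a point with
  \<open>Im z \<le> N * Re z\<close> one sees the right side of the boundary within distance \<open>O(E z)\<close>, whence
  \<open>delta_plus = O(delta_minus)\<close> at \<open>f z = p + i t\<close>; the reflected statement holds for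
  \<open>Im z \<ge> - N * Re z\<close>.

  Conversely, let \<open>Arg z\<close> be close to \<open>- pi / 2\<close>. By Harnack this persists along the horizontal path
  from \<open>p + i t\<close> to the left over any bounded multiple of \<open>E z\<close>: the path keeps its distance from the
  boundary, for otherwise it would see the right side within a distance too small to reach \<open>Re p\<close>. A
  left boundary point within \<open>O(E z)\<close> would then lie below this path, and the half-plane property of
  difference quotients at the left end of the path contradicts the smallness of the angle. Thus
  \<open>delta_plus = o(delta_minus)\<close>.
\<close>

subsection \<open>Schwarz--Pick inequalities and Julia's lemma in the half-plane\<close>

text \<open>For positive real parts this shows that
  \<open>\<bar>u - v\<bar> / \<bar>u + cnj v\<bar>\<close>, the pseudo-hyperbolic distance of the
  half-plane, is below \<open>1\<close>; it also converts bounds on that distance into bounds on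
  real parts.\<close>

lemma norm_add_cnj_power2:
  "(cmod (u + cnj v))\<^sup>2 = (cmod (u - v))\<^sup>2 + 4 * Re u * Re v"
  unfolding cmod_power2 by (simp add: power2_eq_square algebra_simps)

lemma norm_add_cnj_pos:
  assumes "0 < Re u" "0 < Re v"
  shows "0 < cmod (u + cnj v)"
proof -
  have "u + cnj v \<noteq> 0" using assms by (auto simp: complex_eq_iff)
  then show ?thesis by simp
qed

lemma norm_diff_less_norm_add_cnj:
  assumes "0 < Re u" "0 < Re v"
  shows "cmod (u - v) < cmod (u + cnj v)"
  using norm_add_cnj_power2[of u v] assms
  by (intro power2_less_imp_less[of "cmod (u - v)"]) auto

text \<open>The quotient \<open>g\<close> is \<open>P\<close> followed by the Cayley map taking
  \<open>P 0\<close> to \<open>0\<close>, so Schwarz's lemma applies. Clearing the denominator gives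
  the form used in the Harnack estimates below.\<close>

lemma schwarz_pick_disc_halfplane:
  assumes "P holomorphic_on ball 0 1" "\<And>z. z \<in> ball 0 1 \<Longrightarrow> 0 < Re (P z)" "z \<in> ball 0 1"
  shows "cmod (P z - P 0) \<le> cmod z * cmod (P z + cnj (P 0))"
proof -
  define g where "g = (\<lambda>z. (P z - P 0) / (P z + cnj (P 0)))"
  have pos: "0 < cmod (P z + cnj (P 0))" if "z \<in> ball 0 1" for z
    using that assms(2)[of z] assms(2)[of 0] by (intro norm_add_cnj_pos) auto
  have "g holomorphic_on ball 0 1"
    unfolding g_def using pos by (intro holomorphic_intros assms) force
  moreover have "cmod (g z) < 1" if "cmod z < 1" for z
    using that assms(2)[of z] assms(2)[of 0] pos[of z] norm_diff_less_norm_add_cnj[of "P z" "P 0"]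
    by (simp add: g_def norm_divide)
  ultimately have "cmod (g z) \<le> cmod z"
    using assms(3) by (intro Schwarz_Lemma(1)) (auto simp: g_def)
  then show ?thesis
    using pos[OF assms(3)] by (simp add: g_def norm_divide divide_simps)
qed

lemma schwarz_pick_ball_halfplane:
  assumes "P holomorphic_on ball a r" "\<And>z. z \<in> ball a r \<Longrightarrow> 0 < Re (P z)"
    and "cmod (z - a) \<le> k * r" "k < 1" "0 < r"
  shows "cmod (P z - P a) \<le> k * cmod (P z + cnj (P a))"
proof -
  define Q where "Q = (\<lambda>u. P (a + of_real r * u))"
  have sub: "a + of_real r * u \<in> ball a r" if "u \<in> ball 0 1" for u
    using that assms(5) by (simp add: dist_norm norm_mult)
  have "Q holomorphic_on ball 0 1"
    unfolding Q_def
    by (rule holomorphic_on_compose_gen[unfolded o_def, OF _ assms(1)])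
       (use sub in \<open>auto intro!: holomorphic_intros\<close>)
  moreover have "0 < Re (Q u)" if "u \<in> ball 0 1" for u
    using assms(2) sub[OF that] by (simp add: Q_def)
  moreover define u where "u = (z - a) / of_real r"
  have "cmod u \<le> k" using assms(3,5) by (simp add: u_def norm_divide divide_simps)
  moreover have "Q u = P z" "Q 0 = P a" using assms(5) by (simp_all add: Q_def u_def)
  ultimately have "cmod (P z - P a) \<le> cmod u * cmod (P z + cnj (P a))"
    using schwarz_pick_disc_halfplane[of Q u] assms(4) by auto
  also have "\<dots> \<le> k * cmod (P z + cnj (P a))"
    using \<open>cmod u \<le> k\<close> by (simp add: mult_right_mono)
  finally show ?thesis .
qed

text \<open>Precomposition with \<open>m\<close>, the Cayley map from the disc with
  \<open>m 0 = a\<close>, reduces this to the disc; \<open>u\<close> is the preimage of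
  \<open>z\<close>.\<close>

lemma schwarz_pick_halfplane:
  assumes "P holomorphic_on {z. 0 < Re z}" "\<And>z. 0 < Re z \<Longrightarrow> 0 < Re (P z)"
    and "0 < Re z" "0 < Re a"
  shows "cmod (P z - P a) * cmod (z + cnj a) \<le> cmod (z - a) * cmod (P z + cnj (P a))"
proof -
  define m where "m = (\<lambda>u. (a + cnj a * u) / (1 - u))"
  have Re_m: "0 < Re (m u)" if "u \<in> ball 0 1" for u
  proof -
    have n: "cmod u < 1" "1 - u \<noteq> 0" using that by auto
    have "Re ((a + cnj a * u) * cnj (1 - u)) = Re a * (1 - (cmod u)\<^sup>2)"
      unfolding cmod_power2 by (simp add: power2_eq_square algebra_simps)
    moreover have "(cmod u)\<^sup>2 < 1" using n by (simp add: abs_square_less_1)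
    ultimately have "0 < Re ((a + cnj a * u) * cnj (1 - u))" using assms(4) by simp
    then show ?thesis by (simp add: m_def Re_complex_div_gt_0)
  qed
  have "m holomorphic_on ball 0 1"
    unfolding m_def by (intro holomorphic_intros) auto
  then have "(P \<circ> m) holomorphic_on ball 0 1"
    by (rule holomorphic_on_compose_gen[OF _ assms(1)]) (use Re_m in auto)
  moreover define u where "u = (z - a) / (z + cnj a)"
  have pos: "0 < cmod (z + cnj a)" using assms by (intro norm_add_cnj_pos)
  then have nz: "z + cnj a \<noteq> 0" by auto
  have u: "u \<in> ball 0 1"
    using pos norm_diff_less_norm_add_cnj[OF assms(3,4)] by (simp add: u_def norm_divide)
  have "1 - u = (a + cnj a) / (z + cnj a)"
    using nz by (simp add: u_def divide_simps)
  moreover have "a + cnj a * u = z * (a + cnj a) / (z + cnj a)"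
    using nz by (simp add: u_def divide_simps) (simp add: algebra_simps)
  moreover have "a + cnj a \<noteq> 0" using assms(4) by (auto simp: complex_eq_iff)
  ultimately have "m u = z" using nz by (simp add: m_def)
  have "m 0 = a" by (simp add: m_def)
  have "cmod (P z - P a) \<le> cmod u * cmod (P z + cnj (P a))"
    using schwarz_pick_disc_halfplane[of "P \<circ> m" u] \<open>m u = z\<close> \<open>m 0 = a\<close> u
      \<open>(P \<circ> m) holomorphic_on ball 0 1\<close> assms(2) Re_m by auto
  then show ?thesis
    using pos by (simp add: u_def norm_divide field_simps)
qed

lemma norm_le_of_pseudo_dist_le:
  fixes u v :: complex
  assumes "cmod (u - v) \<le> k * cmod (u + cnj v)" "0 \<le> k" "k < 1"
  shows "cmod u \<le> (1 + k) / (1 - k) * cmod v"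
proof -
  have "cmod u - cmod v \<le> k * cmod (u + cnj v)"
    using assms(1) norm_triangle_ineq2[of u v] by linarith
  also have "\<dots> \<le> k * (cmod u + cmod v)"
    using assms(2) norm_triangle_ineq[of u "cnj v"] by (intro mult_left_mono) auto
  finally show ?thesis using assms(3) by (simp add: field_simps)
qed

text \<open>Combined with Schwarz-Pick this is Harnack's inequality for \<open>Re P\<close>.
  Discarding imaginary parts leaves a quadratic inequality in \<open>Re u\<close> and
  \<open>Re v\<close>, which factorizes.\<close>

lemma Re_le_of_pseudo_dist_le:
  fixes u v :: complex
  assumes "cmod (u - v) \<le> k * cmod (u + cnj v)" "0 \<le> k" "k < 1" "0 < Re u" "0 < Re v"
  shows "Re u \<le> (1 + k) / (1 - k) * Re v"
proof (rule ccontr)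
  assume "\<not> ?thesis"
  then have 1: "(1 + k) * Re v < (1 - k) * Re u"
    using assms(3) by (simp add: field_simps)
  have 2: "(1 - k) * Re v \<le> (1 + k) * Re v" using assms by (intro mult_right_mono) auto
  have 3: "(1 - k) * Re u \<le> (1 + k) * Re u" using assms by (intro mult_right_mono) auto
  have "(cmod (u - v))\<^sup>2 \<le> k\<^sup>2 * (cmod (u + cnj v))\<^sup>2"
    using assms(1,2) by (metis norm_ge_zero power_mono power_mult_distrib)
  then have "(1 - k\<^sup>2) * (cmod (u + cnj v))\<^sup>2 \<le> 4 * Re u * Re v"
    using norm_add_cnj_power2[of u v] by (simp add: algebra_simps)
  moreover have "(Re u + Re v)\<^sup>2 \<le> (cmod (u + cnj v))\<^sup>2"
    by (simp add: cmod_power2)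
  moreover have "0 \<le> 1 - k\<^sup>2" using assms(2,3) by (simp add: power_le_one)
  ultimately have 4: "(1 - k\<^sup>2) * (Re u + Re v)\<^sup>2 \<le> 4 * Re u * Re v"
    by (meson mult_left_mono order_trans)
  have "0 < ((1 - k) * Re u - (1 + k) * Re v) * ((1 + k) * Re u - (1 - k) * Re v)"
    using 1 2 3 by (intro mult_pos_pos) auto
  also have "\<dots> = (1 - k\<^sup>2) * (Re u + Re v)\<^sup>2 - 4 * Re u * Re v"
    by (simp add: power2_eq_square algebra_simps)
  finally show False using 4 by simp
qed

text \<open>
  The boundary dilation at \<open>\<infinity>\<close> is read off along the orbit itself: if \<open>Re (\<psi> z) < Re z\<close>, then
  the Schwarz--Pick inequality between \<open>z\<close> and \<open>a n\<close> makes \<open>Re (a n) / \<bar>a n\<bar>\<^sup>2\<close>, which tends to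
  \<open>0\<close>, eventually increasing.
\<close>
lemma julia_halfplane:
  assumes hol: "\<psi> holomorphic_on {z. 0 < Re z}"
    and map: "\<And>z. 0 < Re z \<Longrightarrow> 0 < Re (\<psi> z)"
    and a: "\<And>n. 0 < Re (a n)" "\<And>n. a (Suc n) = \<psi> (a n)"
    and lim: "filterlim a at_infinity sequentially"
    and z: "0 < Re z"
  shows "Re z \<le> Re (\<psi> z)"
proof (rule ccontr)
  assume less: "\<not> ?thesis"
  \<comment> \<open>\<open>c n\<close> equals \<open>Re (inverse (a n))\<close>: positive, and
    tending to \<open>0\<close>.\<close>
  define c where "c = (\<lambda>n. Re (a n) / (cmod (a n))\<^sup>2)"
  have a0: "a n \<noteq> 0" for n using a(1)[of n] by auto
  have cpos: "0 < c n" for n using a(1)[of n] a0[of n] by (simp add: c_def)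
  have inv0: "(\<lambda>n. inverse (a n)) \<longlonglongrightarrow> 0"
    using lim by (rule filterlim_compose[OF tendsto_inverse_0])
  have c0: "c \<longlonglongrightarrow> 0"
  proof (rule tendsto_sandwich[of "\<lambda>_. 0"])
    show "\<forall>\<^sub>F n in sequentially. c n \<le> cmod (inverse (a n))"
    proof (intro always_eventually allI)
      fix n
      have "Re (a n) / (cmod (a n))\<^sup>2 \<le> cmod (a n) / (cmod (a n))\<^sup>2"
        by (intro divide_right_mono complex_Re_le_cmod) auto
      then show "c n \<le> cmod (inverse (a n))"
        using a0[of n] by (simp add: c_def norm_divide power2_eq_square inverse_eq_divide)
    qed
    show "(\<lambda>n. cmod (inverse (a n))) \<longlonglongrightarrow> 0" using tendsto_norm_zero[OF inv0] .
  qed (use cpos in \<open>auto intro!: always_eventually less_imp_le\<close>)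
  \<comment> \<open>\<open>A\<close> and \<open>B\<close> are what remains of
    \<open>\<bar>z + cnj (a n)\<bar>\<^sup>2\<close> and its image counterpart once the squared
    moduli of the orbit points are factored out; both tend to \<open>1\<close>.\<close>
  define A where "A = (\<lambda>n. (cmod (1 + z * cnj (inverse (a n))))\<^sup>2)"
  define B where "B = (\<lambda>n. (cmod (1 + \<psi> z * cnj (inverse (a (Suc n)))))\<^sup>2)"
  have ineq: "Re z * c n * B n \<le> Re (\<psi> z) * c (Suc n) * A n" for n
  proof -
    have sp: "cmod (\<psi> z - a (Suc n)) * cmod (z + cnj (a n))
        \<le> cmod (z - a n) * cmod (\<psi> z + cnj (a (Suc n)))"
      using schwarz_pick_halfplane[OF hol map z a(1)[of n]] a(2)[of n] by simp
    have "(cmod (\<psi> z - a (Suc n)))\<^sup>2 * (cmod (z + cnj (a n)))\<^sup>2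
        \<le> (cmod (z - a n))\<^sup>2 * (cmod (\<psi> z + cnj (a (Suc n))))\<^sup>2"
      using power_mono[OF sp, of 2] by (simp add: power_mult_distrib)
    then have main: "Re z * Re (a n) * (cmod (\<psi> z + cnj (a (Suc n))))\<^sup>2
        \<le> Re (\<psi> z) * Re (a (Suc n)) * (cmod (z + cnj (a n)))\<^sup>2"
      using norm_add_cnj_power2[of "\<psi> z" "a (Suc n)"] norm_add_cnj_power2[of z "a n"]
      by (simp add: algebra_simps)
    have e: "(cmod (w + cnj b))\<^sup>2 = (cmod b)\<^sup>2 * (cmod (1 + w * cnj (inverse b)))\<^sup>2"
      if "b \<noteq> 0" for w b :: complex
    proof -
      have "w + cnj b = cnj b * (1 + w * cnj (inverse b))"
        using that by (simp add: field_simps)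
      then show ?thesis by (metis complex_mod_cnj norm_mult power_mult_distrib)
    qed
    have "Re z * Re (a n) * ((cmod (a (Suc n)))\<^sup>2 * B n)
        \<le> Re (\<psi> z) * Re (a (Suc n)) * ((cmod (a n))\<^sup>2 * A n)"
      using main unfolding A_def B_def e[OF a0[of "Suc n"]] e[OF a0[of n]] .
    then show ?thesis
      using a0[of n] a0[of "Suc n"] by (simp add: c_def field_simps)
  qed
  have "A \<longlonglongrightarrow> (cmod (1 + z * cnj 0))\<^sup>2" unfolding A_def by (intro tendsto_intros inv0)
  then have "(\<lambda>n. Re (\<psi> z) * A n) \<longlonglongrightarrow> Re (\<psi> z)"
    using tendsto_mult_left[of A 1 sequentially "Re (\<psi> z)"] by simp
  moreover have "B \<longlonglongrightarrow> (cmod (1 + \<psi> z * cnj 0))\<^sup>2"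
    unfolding B_def by (intro tendsto_intros LIMSEQ_Suc[OF inv0])
  then have "(\<lambda>n. Re z * B n) \<longlonglongrightarrow> Re z"
    using tendsto_mult_left[of B 1 sequentially "Re z"] by simp
  \<comment> \<open>A number strictly between the two limits makes \<open>c\<close> eventually
    nondecreasing, which a positive sequence tending to \<open>0\<close> cannot be.\<close>
  moreover obtain m where m: "Re (\<psi> z) < m" "m < Re z"
    using less dense by (meson not_le)
  ultimately have "\<forall>\<^sub>F n in sequentially. Re (\<psi> z) * A n < m \<and> m < Re z * B n"
    by (intro eventually_conj order_tendstoD)
  then obtain N where N: "\<And>n. n \<ge> N \<Longrightarrow> Re (\<psi> z) * A n < m \<and> m < Re z * B n"
    by (auto simp: eventually_sequentially)
  have "0 < m" using m map[OF z] by linarith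
  have step: "c n \<le> c (Suc n)" if "n \<ge> N" for n
  proof -
    have "m * c n \<le> (Re z * B n) * c n" using N[OF that] cpos[of n] by (intro mult_right_mono) auto
    also have "\<dots> \<le> (Re (\<psi> z) * A n) * c (Suc n)" using ineq[of n] by (simp add: mult_ac)
    also have "\<dots> \<le> m * c (Suc n)"
      using N[OF that] cpos[of "Suc n"] by (intro mult_right_mono) auto
    finally show ?thesis using \<open>0 < m\<close> by simp
  qed
  have "c N \<le> c n" if "n \<ge> N" for n
    using that by (induction n rule: dec_induct) (use step in \<open>auto intro: order_trans\<close>)
  then have "c N \<le> 0"
    using c0 by (intro LIMSEQ_le_const[of c 0]) auto
  then show False using cpos[of N] by simp
qed

subsection \<open>Conformal maps of the half-plane with derivative in the upper half-plane\<close>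

lemma mean_value_circle:
  assumes "P holomorphic_on cball a r" "0 < r"
  shows "((\<lambda>x. P (a + of_real r * exp (2 * of_real pi * \<i> * of_real x))) has_integral P a) {0..1}"
proof -
  have "((\<lambda>u. P u / (u - a)) has_contour_integral (2 * of_real pi * \<i> * P a)) (circlepath a r)"
    using Cauchy_integral_circlepath_simple[OF assms(1), of a] assms(2) by simp
  then have "((\<lambda>x. P (circlepath a r x) / (circlepath a r x - a)
      * vector_derivative (circlepath a r) (at x within {0..1}))
      has_integral (2 * of_real pi * \<i> * P a)) {0..1}"
    by (simp add: has_contour_integral_def)
  then have "((\<lambda>x. 2 * of_real pi * \<i> * P (a + of_real r * exp (2 * of_real pi * \<i> * of_real x)))
      has_integral (2 * of_real pi * \<i> * P a)) {0..1}"
  proof (rule has_integral_eq[rotated])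
    fix x :: real assume "x \<in> {0..1}"
    then have v: "vector_derivative (circlepath a r) (at x within {0..1})
        = 2 * pi * \<i> * r * exp (2 * of_real pi * \<i> * x)"
      by (intro vector_derivative_circlepath01) auto
    have c: "circlepath a r x = a + of_real r * exp (2 * of_real pi * \<i> * x)"
      by (simp add: circlepath)
    show "P (circlepath a r x) / (circlepath a r x - a)
        * vector_derivative (circlepath a r) (at x within {0..1})
        = 2 * of_real pi * \<i> * P (a + of_real r * exp (2 * of_real pi * \<i> * of_real x))"
      unfolding v c using assms(2) by simp
  qed
  from has_integral_mult_right[OF this, of "1 / (2 * of_real pi * \<i>)"] show ?thesis by simp
qed

text \<open>Under the mean value integral, \<open>Re P\<close> is at least \<open>l\<close> on the
  arc, a fraction \<open>\<theta> / (2 * pi)\<close> of the circle, and at least \<open>0\<close>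
  elsewhere. The arc runs downwards from the leftmost point, as a descent to the imaginary axis
  requires.\<close>

lemma arc_bound_le_centre:
  assumes hol: "P holomorphic_on cball a r" and r: "0 < r"
    and nonneg: "\<And>z. z \<in> cball a r \<Longrightarrow> 0 \<le> Re (P z)"
    and \<theta>: "0 \<le> \<theta>" "\<theta> \<le> pi"
    and arc: "\<And>\<alpha>. 0 \<le> \<alpha> \<Longrightarrow> \<alpha> \<le> \<theta> \<Longrightarrow> l \<le> Re (P (a - of_real r * exp (\<i> * of_real \<alpha>)))"
  shows "l * \<theta> \<le> 2 * pi * Re (P a)"
proof -
  define c where "c = (\<lambda>x::real. a + of_real r * exp (2 * of_real pi * \<i> * of_real x))"
  \<comment> \<open>In this parametrization the leftmost point is at \<open>1/2\<close> and the arc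
    is \<open>{1/2..b}\<close>.\<close>
  define b where "b = 1/2 + \<theta> / (2 * pi)"
  have b: "1/2 \<le> b" "b \<le> 1" using \<theta> by (auto simp: b_def field_simps)
  have int: "((\<lambda>x. Re (P (c x))) has_integral Re (P a)) {0..1}"
    using has_integral_linear[OF mean_value_circle[OF hol r] bounded_linear_Re]
    by (simp add: o_def c_def)
  have c_ball: "c x \<in> cball a r" for x
    using r by (simp add: c_def dist_norm norm_mult)
  have "((\<lambda>x. l) has_integral (b - 1/2) *\<^sub>R l) {1/2..b}"
    using b has_integral_const_real[of l "1/2" b] by simp
  then have "((\<lambda>x. if x \<in> {1/2..b} then l else 0) has_integral (b - 1/2) *\<^sub>R l) {0..1}"
    using b by (subst has_integral_restrict) auto
  then have "(b - 1/2) *\<^sub>R l \<le> Re (P a)"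
  proof (rule has_integral_le[OF _ int])
    fix x :: real assume "x \<in> {0..1}"
    show "(if x \<in> {1/2..b} then l else 0) \<le> Re (P (c x))"
    proof (cases "x \<in> {1/2..b}")
      case True
      define \<alpha> where "\<alpha> = 2 * pi * (x - 1/2)"
      have "0 \<le> \<alpha>" "\<alpha> \<le> \<theta>" using True by (auto simp: \<alpha>_def b_def field_simps)
      moreover have "exp (2 * of_real pi * \<i> * of_real x) = - exp (\<i> * of_real \<alpha>)"
      proof -
        have "2 * of_real pi * \<i> * of_real x = \<i> * of_real \<alpha> + \<i> * of_real pi"
          by (simp add: \<alpha>_def algebra_simps)
        then show ?thesis by (simp add: exp_add mult.commute[of \<i> "of_real pi"])
      qed
      then have "c x = a - of_real r * exp (\<i> * of_real \<alpha>)" by (simp add: c_def)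
      ultimately show ?thesis using arc True by auto
    qed (use nonneg c_ball in auto)
  qed
  then show ?thesis by (simp add: b_def field_simps)
qed

section \<open>Upward maps and their difference quotients\<close>

abbreviation right_halfplane :: "complex set" where
  "right_halfplane \<equiv> {z. 0 < Re z}"

lemma open_right_halfplane: "open right_halfplane"
  by (rule open_halfspace_Re_gt)

text \<open>This abstracts the Koenigs function read in the half-plane with the Denjoy-Wolff point
  at infinity; \<open>up\<close> is starlikeness at infinity. The base point of the estimates below
  is \<open>f 1\<close>.\<close>

locale upward_map =
  fixes f :: "complex \<Rightarrow> complex"
  assumes holo: "f holomorphic_on right_halfplane"
    and inj: "inj_on f right_halfplane"
    and Im_deriv_nonneg: "\<And>z. 0 < Re z \<Longrightarrow> 0 \<le> Im (deriv f z)"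
    and up: "\<And>z t. 0 < Re z \<Longrightarrow> 0 \<le> t \<Longrightarrow> f z + \<i> * of_real t \<in> f ` right_halfplane"
begin

definition F :: "complex \<Rightarrow> complex" where
  "F = the_inv_into right_halfplane f"

abbreviation Om :: "complex set" where
  "Om \<equiv> f ` right_halfplane"

text \<open>Comparable to the distance from \<open>f z\<close> to the boundary of the image.\<close>
definition E :: "complex \<Rightarrow> real" where
  "E z = Re z * cmod (deriv f z)"

lemma open_Om: "open Om"
  using open_mapping_thm3[OF holo open_right_halfplane inj] .

lemma F_f [simp]: "0 < Re z \<Longrightarrow> F (f z) = z"
  using the_inv_into_f_f[OF inj] by (simp add: F_def)

lemma f_F [simp]: "w \<in> Om \<Longrightarrow> f (F w) = w"
  using f_the_inv_into_f[OF inj] by (simp add: F_def)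

lemma Re_F: "w \<in> Om \<Longrightarrow> 0 < Re (F w)"
  by auto

lemma F_holo: "F holomorphic_on Om"
proof -
  obtain g where g: "g holomorphic_on Om" "\<And>z. z \<in> right_halfplane \<Longrightarrow> g (f z) = z"
    using holomorphic_has_inverse[OF holo open_right_halfplane inj] by metis
  show ?thesis by (rule holomorphic_transform[OF g(1)]) (use g(2) in auto)
qed

lemma up_Om: "w \<in> Om \<Longrightarrow> 0 \<le> t \<Longrightarrow> w + \<i> * of_real t \<in> Om"
  using up by auto

lemma deriv_nonzero: "0 < Re z \<Longrightarrow> deriv f z \<noteq> 0"
  using holomorphic_injective_imp_regular[OF holo open_right_halfplane inj] by auto

lemma E_pos: "0 < Re z \<Longrightarrow> 0 < E z"
  using deriv_nonzero by (simp add: E_def)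

text \<open>The Noshiro-Warschawski argument: along the segment from \<open>a\<close> to
  \<open>z\<close>, the function \<open>\<phi>\<close> has derivative
  \<open>\<bar>z - a\<bar>\<^sup>2 * Im f'\<close>, so it does not decrease. Multiplying by the
  conjugate avoids a division.\<close>

lemma noshiro:
  assumes "0 < Re z" "0 < Re a"
  shows "0 \<le> Im ((f z - f a) * cnj (z - a))"
proof -
  define c where "c = (\<lambda>s::real. a + of_real s * (z - a))"
  define \<phi> where "\<phi> = (\<lambda>s. Im (f (c s) * cnj (z - a)))"
  have "\<phi> 0 \<le> \<phi> 1"
  proof (rule DERIV_nonneg_imp_nondecreasing[of 0 1])
    fix s :: real assume s: "0 \<le> s" "s \<le> 1"
    have "Re (c s) = (1 - s) * Re a + s * Re z" by (simp add: c_def algebra_simps)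
    then have Re_c: "0 < Re (c s)" using s assms by (cases "s = 0") (auto intro: add_nonneg_pos)
    then have f': "(f has_field_derivative deriv f (c s)) (at (c s))"
      using holo open_right_halfplane by (intro holomorphic_derivI) auto
    have "(c has_vector_derivative (z - a)) (at s)"
      unfolding c_def by (auto intro!: derivative_eq_intros)
    then have "((\<lambda>s. f (c s)) has_vector_derivative (z - a) * deriv f (c s)) (at s)"
      using field_vector_diff_chain_at[of c "z - a" s f] f' by (simp add: o_def)
    then have "((\<lambda>s. f (c s) * cnj (z - a)) has_vector_derivative
        (z - a) * deriv f (c s) * cnj (z - a)) (at s)"
      by (intro has_vector_derivative_mult_left)
    then have "(\<phi> has_vector_derivative Im ((z - a) * deriv f (c s) * cnj (z - a))) (at s)"
      unfolding \<phi>_def by (rule bounded_linear.has_vector_derivative[OF bounded_linear_Im])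
    moreover have "(z - a) * deriv f (c s) * cnj (z - a)
        = of_real ((cmod (z - a))\<^sup>2) * deriv f (c s)"
      using complex_norm_square[of "z - a"] by (simp add: mult_ac)
    then have "Im ((z - a) * deriv f (c s) * cnj (z - a)) = (cmod (z - a))\<^sup>2 * Im (deriv f (c s))"
      by (simp only: Im_complex_of_real Re_complex_of_real times_complex.sel)
    ultimately have "(\<phi> has_real_derivative (cmod (z - a))\<^sup>2 * Im (deriv f (c s))) (at s)"
      by (simp add: has_real_derivative_iff_has_vector_derivative)
    then show "\<exists>y. (\<phi> has_real_derivative y) (at s) \<and> 0 \<le> y"
      using Im_deriv_nonneg[OF Re_c]
      by (intro exI[of _ "(cmod (z - a))\<^sup>2 * Im (deriv f (c s))"] conjI) auto
  qed simp
  then show ?thesis by (simp add: \<phi>_def c_def algebra_simps)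
qed

text \<open>The part of the boundary facing \<open>Im z \<le> 0\<close> lies to the right of \<open>f 1\<close>, or below it.\<close>
lemma quadrant:
  assumes "0 < Re z" "Re z < 1" "Im z \<le> 0"
  shows "Re (f 1) \<le> Re (f z) \<or> Im (f z) \<le> Im (f 1)"
proof (rule ccontr)
  assume "\<not> ?thesis"
  then have *: "Re (f z) - Re (f 1) < 0" "0 < Im (f z) - Im (f 1)" by auto
  have "0 \<le> (Im (f z) - Im (f 1)) * (Re z - 1) - (Re (f z) - Re (f 1)) * Im z"
    using noshiro[of z 1] assms by (simp add: algebra_simps)
  moreover have "(Im (f z) - Im (f 1)) * (Re z - 1) < 0"
    using * assms by (intro mult_pos_neg) auto
  moreover have "0 \<le> (Re (f z) - Re (f 1)) * Im z"
    using * assms by (intro mult_nonpos_nonpos) auto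
  ultimately show False by linarith
qed

text \<open>
  Unlike \<open>- \<i> f'\<close> itself, its power \<open>3/4\<close> has modulus comparable to its real part, so that
  positivity controls the modulus of \<open>f'\<close>.
\<close>
definition R :: "complex \<Rightarrow> complex" where
  "R z = exp (3 / 4 * Ln (- \<i> * deriv f z))"

section \<open>Distortion of \<open>f'\<close> via the power \<open>R\<close>\<close>

lemma R_holo: "R holomorphic_on right_halfplane"
proof -
  have "- \<i> * deriv f z \<notin> \<real>\<^sub>\<le>\<^sub>0" if "z \<in> right_halfplane" for z
  proof -
    have "0 \<le> Re (- \<i> * deriv f z)" "- \<i> * deriv f z \<noteq> 0"
      using Im_deriv_nonneg[of z] deriv_nonzero[of z] that by auto
    then show ?thesis by (metis antisym_conv complex_nonpos_Reals_iff complex_eq_iff zero_complex.sel)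
  qed
  then show ?thesis unfolding R_def
    by (intro holomorphic_intros holomorphic_deriv[OF holo open_right_halfplane]) auto
qed

lemma norm_R_power4: "cmod (R z) ^ 4 = cmod (deriv f z) ^ 3" if "0 < Re z"
proof -
  from that have pos: "0 < cmod (deriv f z)" using deriv_nonzero by simp
  have "cmod (R z) ^ 4 = exp (3 * ln (cmod (deriv f z)))"
    using deriv_nonzero[OF that] by (simp add: R_def norm_mult flip: exp_of_nat_mult)
  also have "\<dots> = exp (ln (cmod (deriv f z))) ^ 3"
    by (simp flip: exp_of_nat_mult)
  finally show ?thesis using pos by simp
qed

text \<open>The argument of \<open>- \<i> * f'\<close> is at most \<open>pi / 2\<close> in modulus,
  so that of \<open>R\<close> is at most \<open>3 * pi / 8\<close>.\<close>

lemma Re_R_ge: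
  assumes "0 < Re z"
  shows "cos (3 * pi / 8) * cmod (R z) \<le> Re (R z)"
proof -
  define w where "w = - \<i> * deriv f z"
  have w: "0 \<le> Re w" "w \<noteq> 0"
    using Im_deriv_nonneg[OF assms] deriv_nonzero[OF assms] by (auto simp: w_def)
  then have "\<bar>Im (Ln w)\<bar> \<le> pi / 2" using Re_Ln_pos_le by blast
  then have "cos (3 * pi / 8) \<le> cos \<bar>3 / 4 * Im (Ln w)\<bar>"
    by (intro cos_monotone_0_pi_le) (auto simp: abs_mult)
  then have "cos (3 * pi / 8) \<le> cos (3 / 4 * Im (Ln w))" by (simp only: cos_abs_real)
  then have "cos (3 * pi / 8) * cmod (exp (3 / 4 * Ln w)) \<le> Re (exp (3 / 4 * Ln w))"
    by (simp add: Re_exp mult.commute[of "cos _"] mult_left_mono)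
  then show ?thesis by (simp only: R_def w_def)
qed

lemma cos_3pi_8_pos: "0 < cos (3 * pi / 8)"
  by (intro cos_gt_zero) auto

lemma Re_R_pos: "0 < Re z \<Longrightarrow> 0 < Re (R z)"
  using Re_R_ge[of z] cos_3pi_8_pos
  by (smt (verit) R_def exp_not_eq_zero mult_pos_pos zero_less_norm_iff)

text \<open>Schwarz-Pick for \<open>R\<close> compares \<open>\<bar>R\<bar>\<close> at the two
  points with factor \<open>q\<close>. For \<open>f'\<close> this means
  \<open>q powr (4 / 3)\<close>, and the exponent is rounded up to \<open>2\<close>.\<close>

lemma deriv_harnack:
  assumes "0 < Re z" "0 < Re a" "cmod (z - a) \<le> k * cmod (z + cnj a)" "0 \<le> k" "k < 1"
  shows "cmod (deriv f z) \<le> ((1 + k) / (1 - k))\<^sup>2 * cmod (deriv f a)"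
proof -
  define q where "q = (1 + k) / (1 - k)"
  have q: "1 \<le> q" using assms by (simp add: q_def)
  have pos: "0 < cmod (z + cnj a)" using assms by (intro norm_add_cnj_pos)
  have "cmod (R z - R a) * cmod (z + cnj a) \<le> cmod (z - a) * cmod (R z + cnj (R a))"
    using schwarz_pick_halfplane[OF R_holo] Re_R_pos assms by auto
  also have "\<dots> \<le> k * cmod (z + cnj a) * cmod (R z + cnj (R a))"
    using assms by (intro mult_right_mono) auto
  finally have "cmod (R z - R a) \<le> k * cmod (R z + cnj (R a))"
    using pos by (simp add: mult.assoc mult.left_commute mult.commute[of _ "cmod (z + cnj a)"])
  then have "cmod (R z) \<le> q * cmod (R a)"
    unfolding q_def using assms by (intro norm_le_of_pseudo_dist_le)
  then have "cmod (R z) ^ 4 \<le> (q * cmod (R a)) ^ 4" by (intro power_mono) auto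
  then have "cmod (deriv f z) ^ 3 \<le> q ^ 4 * cmod (deriv f a) ^ 3"
    using assms by (simp add: norm_R_power4 power_mult_distrib)
  also have "\<dots> \<le> q ^ 6 * cmod (deriv f a) ^ 3"
    using q by (intro mult_right_mono power_increasing) auto
  also have "\<dots> = (q\<^sup>2 * cmod (deriv f a)) ^ 3" by (simp only: power_mult_distrib flip: power_mult) simp
  finally have "cmod (deriv f z) ^ 3 \<le> (q\<^sup>2 * cmod (deriv f a)) ^ 3" .
  moreover have "0 \<le> q\<^sup>2 * cmod (deriv f a)" by simp
  ultimately show ?thesis unfolding q_def[symmetric]
    using power_mono_iff[of "cmod (deriv f z)" "q\<^sup>2 * cmod (deriv f a)" 3] by simp
qed

text \<open>The bound \<open>Re a \<le> \<bar>z + cnj a\<bar>\<close> turns a Euclidean radius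
  relative to \<open>Re a\<close> into a pseudo-hyperbolic one.\<close>

lemma deriv_harnack_cball:
  assumes "0 < Re a" "cmod (z - a) \<le> k * Re a" "0 \<le> k" "k < 1"
  shows "0 < Re z" "cmod (deriv f z) \<le> ((1 + k) / (1 - k))\<^sup>2 * cmod (deriv f a)"
proof -
  have "Re a - Re z \<le> k * Re a" using assms(2) complex_Re_le_cmod[of "a - z"]
    by (simp add: norm_minus_commute)
  moreover have "k * Re a < Re a" using assms by simp
  ultimately show z: "0 < Re z" by simp
  have "Re a \<le> Re (z + cnj a)" using z by simp
  also have "\<dots> \<le> cmod (z + cnj a)" by (rule complex_Re_le_cmod)
  finally have "cmod (z - a) \<le> k * cmod (z + cnj a)"
    using assms by (meson mult_left_mono order_trans)
  then show "cmod (deriv f z) \<le> ((1 + k) / (1 - k))\<^sup>2 * cmod (deriv f a)"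
    using assms z by (intro deriv_harnack)
qed

text \<open>The constant \<open>3 - 2 * sqrt 2\<close> of \<open>Bloch_lemma\<close>, times the
  relative radius \<open>1 / 10\<close> of the disc on which it is applied.\<close>

definition cB :: real where "cB = (3 - 2 * sqrt 2) / 10"

lemma cB: "0 < cB" "cB \<le> 1"
proof -
  have "sqrt 2 < 3 / 2" by (rule real_less_lsqrt) (auto simp: power2_eq_square)
  then show "0 < cB" by (simp add: cB_def)
  have "3 - 2 * sqrt 2 \<le> 10" using real_sqrt_ge_zero[of 2] by linarith
  then show "cB \<le> 1" unfolding cB_def by simp
qed

text \<open>Bloch's lemma needs the derivative to stay below twice its value at the centre; on
  radius \<open>Re a / 10\<close> it does, since \<open>(11 / 9)\<^sup>2 \<le> 2\<close>.\<close>

lemma ball_subset_Om: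
  assumes "0 < Re a"
  shows "ball (f a) (cB * E a) \<subseteq> Om"
proof -
  have sub: "cball a (Re a / 10) \<subseteq> right_halfplane"
    using deriv_harnack_cball(1)[of a _ "1/10"] assms by (auto simp: dist_norm norm_minus_commute)
  have "cmod (deriv f z) \<le> 2 * cmod (deriv f a)" if "z \<in> ball a (Re a / 10)" for z
  proof -
    have "cmod (deriv f z) \<le> ((1 + 1/10) / (1 - 1/10))\<^sup>2 * cmod (deriv f a)"
      using that assms by (intro deriv_harnack_cball(2)) (auto simp: dist_norm norm_minus_commute)
    also have "\<dots> \<le> 2 * cmod (deriv f a)"
      by (intro mult_right_mono) (auto simp: power2_eq_square)
    finally show ?thesis .
  qed
  then have "ball (f a) ((3 - 2 * sqrt 2) * (Re a / 10) * norm (deriv f a)) \<subseteq> f ` ball a (Re a / 10)"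
    using assms sub by (intro Bloch_lemma holomorphic_on_subset[OF holo]) auto
  also have "\<dots> \<subseteq> Om" using sub ball_subset_cball by (intro image_mono) blast
  finally show ?thesis by (simp add: cB_def E_def mult_ac)
qed

end

subsection \<open>Boundary points near a given point\<close>

lemma cos_ge_quadratic: "1 - x\<^sup>2 / 2 \<le> cos x" for x :: real
proof -
  have "(sin (x / 2))\<^sup>2 \<le> (x / 2)\<^sup>2"
    using abs_sin_x_le_abs_x[of "x / 2"] by (simp only: abs_le_square_iff)
  then show ?thesis
    using cos_double_sin[of "x / 2"] by (simp add: power_divide)
qed

context upward_map
begin

text \<open>The factor \<open>4 * pi\<close> comes from the arc estimate,
  \<open>cos (3 * pi / 8)\<close> from bounding \<open>\<bar>R\<bar>\<close> by
  \<open>Re R\<close>.\<close>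

definition cK :: real where "cK = 4 * pi / cos (3 * pi / 8)"

text \<open>Chosen so that \<open>th\<^sup>2 * cK ^ 4 = 1 / 36\<close>, small enough for
  \<open>E\<close> to halve in \<open>descent_step\<close>.\<close>

definition th :: real where "th = 1 / (6 * cK\<^sup>2)"

text \<open>Bounds the Harnack factor \<open>((1 + k) / (1 - k))\<^sup>2\<close> at relative radius
  \<open>k = 1 - th\<^sup>2\<close>.\<close>

definition cM :: real where "cM = 4 / th ^ 4"

lemma cK_ge: "12 \<le> cK"
proof -
  have "12 * cos (3 * pi / 8) \<le> 12" by simp
  also have "\<dots> \<le> 4 * pi" using pi_gt3 by simp
  finally show ?thesis using cos_3pi_8_pos by (simp add: cK_def field_simps)
qed

lemma th: "0 < th" "th \<le> 1 / 6" "th\<^sup>2 * cK ^ 4 = 1 / 36"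
proof -
  have K: "0 < cK" using cK_ge by linarith
  then show "0 < th" by (simp add: th_def)
  have "1 \<le> cK\<^sup>2" using cK_ge by (intro one_le_power) linarith
  then show "th \<le> 1 / 6" by (simp add: th_def divide_simps)
  have "th\<^sup>2 * cK ^ 4 = (th * cK\<^sup>2)\<^sup>2" by (simp add: power_mult_distrib)
  also have "th * cK\<^sup>2 = 1 / 6" using K by (simp add: th_def)
  finally show "th\<^sup>2 * cK ^ 4 = 1 / 36" by (simp add: power2_eq_square)
qed

lemma cM_pos: "0 < cM"
  using th by (simp add: cM_def)

text \<open>
  A step towards the boundary that does not move upwards and halves \<open>E\<close>: on a short arc of the
  circle of radius \<open>(1 - th\<^sup>2) * Re z\<close>, the mean value property bounds \<open>Re R\<close> somewhere by
  \<open>O(1 / th)\<close>, hence \<open>\<bar>f'\<bar>\<close> by \<open>O(th powr (- 4 / 3))\<close>, whereas \<open>Re\<close> is \<open>O(th\<^sup>2)\<close> on the arc.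
\<close>
lemma descent_step:
  assumes z: "0 < Re z"
  shows "\<exists>z'. 0 < Re z' \<and> Im z' \<le> Im z \<and> Re z' \<le> Re z / 2 \<and> E z' \<le> E z / 2 \<and>
    cmod (f z' - f z) \<le> cM * E z"
proof -
  define k where "k = 1 - th\<^sup>2"
  have th2: "0 < th\<^sup>2" "th\<^sup>2 \<le> 1 / 36"
    using th power_mono[of th "1/6" 2] by (auto simp: power_divide)
  then have k: "0 < k" "k < 1" by (auto simp: k_def)
  define \<rho> where "\<rho> = k * Re z"
  have \<rho>: "0 < \<rho>" "\<rho> \<le> Re z" using k z by (auto simp: \<rho>_def mult_le_cancel_right1)
  have in_ball: "0 < Re u" "cmod (deriv f u) \<le> ((1 + k) / (1 - k))\<^sup>2 * cmod (deriv f z)"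
    if "u \<in> cball z \<rho>" for u
    using deriv_harnack_cball[OF z, of u k] that k
    by (auto simp: \<rho>_def dist_norm norm_minus_commute)
  \<comment> \<open>Otherwise \<open>arc_bound_le_centre\<close> would give
    \<open>4 * pi * Re (R z) \<le> 2 * pi * Re (R z)\<close>.\<close>
  have "\<exists>\<alpha>. 0 \<le> \<alpha> \<and> \<alpha> \<le> th \<and>
      Re (R (z - of_real \<rho> * exp (\<i> * of_real \<alpha>))) < 4 * pi / th * Re (R z)"
  proof (rule ccontr)
    assume "\<not> ?thesis"
    then have "4 * pi / th * Re (R z) * th \<le> 2 * pi * Re (R z)"
      using th \<rho> in_ball pi_gt3 Re_R_pos
      by (intro arc_bound_le_centre[of R z \<rho>] holomorphic_on_subset[OF R_holo])
         (auto simp: not_less less_imp_le subset_iff)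
    then show False using Re_R_pos[OF z] th by simp
  qed
  then obtain \<alpha> where \<alpha>: "0 \<le> \<alpha>" "\<alpha> \<le> th"
    and small: "Re (R (z - of_real \<rho> * exp (\<i> * of_real \<alpha>))) < 4 * pi / th * Re (R z)" by blast
  define z' where "z' = z - of_real \<rho> * exp (\<i> * of_real \<alpha>)"
  have z'_ball: "z' \<in> cball z \<rho>" using \<rho> by (simp add: z'_def dist_norm norm_mult)
  have Re_z': "Re z' = Re z - \<rho> * cos \<alpha>" and Im_z': "Im z' = Im z - \<rho> * sin \<alpha>"
    by (simp_all add: z'_def Re_exp Im_exp)
  have z': "0 < Re z'" using in_ball z'_ball by blast
  have "0 \<le> sin \<alpha>" using \<alpha> th pi_gt3 by (intro sin_ge_zero) auto
  then have 1: "Im z' \<le> Im z" using \<rho> by (simp add: Im_z')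
  have "\<alpha>\<^sup>2 \<le> th\<^sup>2" using \<alpha> by (intro power_mono)
  then have "1 - th\<^sup>2 / 2 \<le> cos \<alpha>" using cos_ge_quadratic[of \<alpha>] by linarith
  then have "(1 - th\<^sup>2) * (1 - th\<^sup>2 / 2) \<le> k * cos \<alpha>"
    unfolding k_def using th2 by (intro mult_left_mono) auto
  moreover have "1 - 3 / 2 * th\<^sup>2 \<le> (1 - th\<^sup>2) * (1 - th\<^sup>2 / 2)"
    by (simp add: algebra_simps)
  ultimately have "1 - k * cos \<alpha> \<le> 3 / 2 * th\<^sup>2" by linarith
  then have "(1 - k * cos \<alpha>) * Re z \<le> 3 / 2 * th\<^sup>2 * Re z" using z by (intro mult_right_mono) auto
  then have 2: "Re z' \<le> 3 / 2 * th\<^sup>2 * Re z" by (simp add: Re_z' \<rho>_def algebra_simps)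
  also have "\<dots> \<le> 1 / 2 * Re z" using th2 z by (intro mult_right_mono) auto
  finally have 3: "Re z' \<le> Re z / 2" by simp
  have "cos (3 * pi / 8) * cmod (R z') \<le> 4 * pi / th * cmod (R z)"
  proof -
    have "cos (3 * pi / 8) * cmod (R z') \<le> 4 * pi / th * Re (R z)"
      using Re_R_ge[OF z'] small by (simp add: z'_def)
    also have "\<dots> \<le> 4 * pi / th * cmod (R z)"
      using th by (intro mult_left_mono complex_Re_le_cmod) auto
    finally show ?thesis .
  qed
  then have "cmod (R z') \<le> 4 * pi / th * cmod (R z) / cos (3 * pi / 8)"
    using cos_3pi_8_pos by (simp only: pos_le_divide_eq mult.commute[of "cos _"])
  then have R': "cmod (R z') \<le> cK / th * cmod (R z)"
    by (simp add: cK_def mult.commute)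
  \<comment> \<open>Cubing replaces \<open>\<bar>f'\<bar>\<close> by
    \<open>\<bar>R\<bar> ^ 4\<close>. The powers of \<open>th\<close> combine to
    \<open>th\<^sup>2\<close>, and the total factor \<open>27 / 288\<close> is below
    \<open>1 / 8\<close>.\<close>
  have "E z' ^ 3 = Re z' ^ 3 * cmod (R z') ^ 4"
    using norm_R_power4[OF z'] by (simp add: E_def power_mult_distrib)
  also have "\<dots> \<le> (3 / 2 * th\<^sup>2 * Re z) ^ 3 * (cK / th * cmod (R z)) ^ 4"
    using R' 2 z' z by (intro mult_mono power_mono) auto
  also have "\<dots> = 27 / 8 * (th\<^sup>2 * cK ^ 4) * (Re z ^ 3 * cmod (R z) ^ 4)"
    using th(1) by (simp add: power_mult_distrib power_divide field_simps eval_nat_numeral)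
  also have "\<dots> = 27 / 288 * E z ^ 3"
    using norm_R_power4[OF z] by (simp add: E_def power_mult_distrib th)
  also have "\<dots> \<le> (E z / 2) ^ 3"
    using E_pos[OF z] by (simp add: power_divide)
  finally have "E z' ^ 3 \<le> (E z / 2) ^ 3" .
  then have 4: "E z' \<le> E z / 2"
    using power_mono_iff[of "E z'" "E z / 2" 3] E_pos[OF z] E_pos[OF z'] by simp
  have "(1 + k) / (1 - k) \<le> 2 / th\<^sup>2" using th2 by (simp add: k_def divide_right_mono)
  then have "((1 + k) / (1 - k))\<^sup>2 \<le> (2 / th\<^sup>2)\<^sup>2" using k by (intro power_mono) auto
  also have "(2 / th\<^sup>2)\<^sup>2 = cM" by (simp add: cM_def power_divide)
  finally have "cmod (deriv f u) \<le> cM * cmod (deriv f z)" if "u \<in> cball z \<rho>" for u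
    using in_ball(2)[OF that] by (meson mult_right_mono norm_ge_zero order_trans)
  then have "cmod (f z' - f z) \<le> cM * cmod (deriv f z) * cmod (z' - z)"
    using z'_ball \<rho> in_ball(1)
    by (intro field_differentiable_bound[of "cball z \<rho>" f "deriv f"])
       (auto intro!: has_field_derivative_at_within holomorphic_derivI[OF holo open_right_halfplane])
  also have "\<dots> \<le> cM * cmod (deriv f z) * Re z"
    using cM_pos \<rho> z'_ball by (intro mult_left_mono) (auto simp: dist_norm norm_minus_commute)
  finally have "cmod (f z' - f z) \<le> cM * E z" by (simp add: E_def mult_ac)
  with 1 3 4 z' show ?thesis by blast
qed

text \<open>Iterating \<open>descent_step\<close> gives points \<open>s n\<close> whose images move
  by at most \<open>cM * E z / 2 ^ n\<close>, hence converge. The limit is outside \<open>Om\<close>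
  because \<open>Re (s n)\<close> tends to \<open>0\<close>, and \<open>quadrant\<close> passes to
  the limit.\<close>

lemma frontier_point_below:
  assumes z: "0 < Re z" "Im z \<le> 0"
  obtains l where "l \<in> frontier Om" "cmod (l - f z) \<le> 2 * cM * E z"
    "Re (f 1) \<le> Re l \<or> Im l \<le> Im (f 1)"
proof -
  obtain c where c: "\<And>z. 0 < Re z \<Longrightarrow> 0 < Re (c z) \<and> Im (c z) \<le> Im z \<and> Re (c z) \<le> Re z / 2 \<and>
      E (c z) \<le> E z / 2 \<and> cmod (f (c z) - f z) \<le> cM * E z"
    using descent_step by metis
  define s where "s = (\<lambda>n. (c ^^ n) z)"
  have s_Suc: "s (Suc n) = c (s n)" for n by (simp add: s_def)
  have s: "0 < Re (s n) \<and> Im (s n) \<le> 0 \<and> Re (s n) \<le> Re z / 2 ^ n \<and> E (s n) \<le> E z / 2 ^ n" for n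
  proof (induction n)
    case 0
    then show ?case using z by (simp add: s_def)
  next
    case (Suc n)
    then show ?case using c[of "s n"] by (auto simp: s_Suc)
  qed
  have step: "cmod (f (s (Suc n)) - f (s n)) \<le> cM * E z * (1 / 2) ^ n" for n
  proof -
    have "cmod (f (s (Suc n)) - f (s n)) \<le> cM * E (s n)" using c[of "s n"] s[of n] by (simp add: s_Suc)
    also have "\<dots> \<le> cM * (E z / 2 ^ n)" using s[of n] cM_pos by (intro mult_left_mono) auto
    finally show ?thesis by (simp add: power_divide)
  qed
  define d where "d = (\<lambda>n. f (s (Suc n)) - f (s n))"
  have geo: "summable (\<lambda>n. cM * E z * (1 / 2 :: real) ^ n)"
    by (intro summable_mult summable_geometric) auto
  then have sum_norm: "summable (\<lambda>n. cmod (d n))"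
    by (rule summable_comparison_test'[of _ 0]) (use step in \<open>auto simp: d_def\<close>)
  have "cmod (suminf d) \<le> (\<Sum>n. cmod (d n))" by (rule summable_norm[OF sum_norm])
  also have "\<dots> \<le> (\<Sum>n. cM * E z * (1 / 2) ^ n)"
    by (intro suminf_le sum_norm geo) (use step in \<open>auto simp: d_def\<close>)
  also have "\<dots> = 2 * cM * E z" using suminf_geometric[of "1/2 :: real"] by (simp add: suminf_mult)
  finally have bound: "cmod (suminf d) \<le> 2 * cM * E z" .
  define l where "l = f z + suminf d"
  have "(\<lambda>n. \<Sum>i<n. d i) \<longlonglongrightarrow> suminf d"
    using summable_LIMSEQ[OF summable_norm_cancel[OF sum_norm]] .
  then have "(\<lambda>n. f z + (\<Sum>i<n. d i)) \<longlonglongrightarrow> l" unfolding l_def by (intro tendsto_intros)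
  moreover have "f z + (\<Sum>i<n. d i) = f (s n)" for n
    unfolding d_def sum_lessThan_telescope[of "\<lambda>n. f (s n)"] by (simp add: s_def)
  ultimately have lim: "(\<lambda>n. f (s n)) \<longlonglongrightarrow> l" by simp
  have Re0: "(\<lambda>n. Re (s n)) \<longlonglongrightarrow> 0"
  proof (rule tendsto_sandwich[of "\<lambda>_. 0" _ _ "\<lambda>n. Re z * (1 / 2) ^ n"])
    show "(\<lambda>n. Re z * (1 / 2) ^ n) \<longlonglongrightarrow> 0"
      by (intro tendsto_mult_right_zero LIMSEQ_power_zero) auto
  qed (use s in \<open>auto intro!: always_eventually less_imp_le simp: power_divide\<close>)
  have "l \<notin> Om"
  proof
    assume l: "l \<in> Om"
    have "isCont F l"
      using F_holo l open_Om by (metis continuous_on_eq_continuous_at holomorphic_on_imp_continuous_on)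
    then have "(\<lambda>n. F (f (s n))) \<longlonglongrightarrow> F l" using lim by (rule isCont_tendsto_compose)
    then have "(\<lambda>n. Re (s n)) \<longlonglongrightarrow> Re (F l)" using s by (auto intro: tendsto_Re)
    then show False using Re0 Re_F[OF l] LIMSEQ_unique by fastforce
  qed
  moreover have "l \<in> closure Om" unfolding closure_sequential
    using lim s by (intro exI[of _ "\<lambda>n. f (s n)"]) auto
  ultimately have "l \<in> frontier Om" using open_Om by (simp add: frontier_def interior_open)
  moreover have "cmod (l - f z) \<le> 2 * cM * E z" using bound by (simp add: l_def)
  moreover have "Re (f 1) \<le> Re l \<or> Im l \<le> Im (f 1)"
  proof (rule ccontr)
    assume "\<not> ?thesis"
    \<comment> \<open>The negated conditions are strict, so they already hold at
      \<open>f (s n)\<close> for large \<open>n\<close>, against \<open>quadrant\<close>.\<close>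
    then have "\<forall>\<^sub>F n in sequentially. Re (f (s n)) < Re (f 1) \<and> Im (f 1) < Im (f (s n)) \<and> Re (s n) < 1"
      using lim Re0 by (intro eventually_conj order_tendstoD[OF tendsto_Re] order_tendstoD[OF tendsto_Im]
        order_tendstoD(2)[OF Re0]) auto
    then obtain n where "Re (f (s n)) < Re (f 1)" "Im (f 1) < Im (f (s n))" "Re (s n) < 1"
      by (auto simp: eventually_sequentially)
    then show False using quadrant[of "s n"] s[of n] by auto
  qed
  ultimately show thesis using that by blast
qed

text \<open>If \<open>Im z > 0\<close>, first descend vertically to the real axis. This move is
  pseudo-hyperbolically bounded, so \<open>f'\<close> changes by at most the factor
  \<open>q\<close>.\<close>

lemma frontier_point_below_sector:
  assumes N: "0 \<le> N"
  obtains C where "1 \<le> C" "\<And>z. 0 < Re z \<Longrightarrow> Im z \<le> N * Re z \<Longrightarrow>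
    \<exists>l\<in>frontier Om. cmod (l - f z) \<le> C * E z \<and> (Re (f 1) \<le> Re l \<or> Im l \<le> Im (f 1))"
proof -
  \<comment> \<open>The pseudo-hyperbolic distance between points of real part \<open>x\<close> at
    vertical distance \<open>N * x\<close>.\<close>
  define k where "k = N / sqrt (N\<^sup>2 + 4)"
  define q where "q = ((1 + k) / (1 - k))\<^sup>2"
  have "N\<^sup>2 < N\<^sup>2 + 4" by simp
  then have "N < sqrt (N\<^sup>2 + 4)" using real_less_rsqrt by blast
  moreover have "0 < sqrt (N\<^sup>2 + 4)" by (simp add: add_nonneg_pos)
  ultimately have k: "0 \<le> k" "k < 1"
    unfolding k_def using N pos_divide_less_eq[of "sqrt (N\<^sup>2 + 4)" N 1] by auto
  have q: "1 \<le> q" using k by (auto simp: q_def)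
  \<comment> \<open>\<open>2 * cM * q\<close> pays for the descent from the real axis and
    \<open>q * N\<close> for the vertical segment; the \<open>1\<close> ensures
    \<open>1 \<le> C\<close>.\<close>
  define C where "C = 1 + 2 * cM * q + q * N"
  have vertical: "cmod (deriv f u) \<le> q * cmod (deriv f z)"
    if "0 < Re z" "Re u = Re z" "\<bar>Im u - Im z\<bar> \<le> N * Re z" for u z
  proof -
    define y where "y = \<bar>Im u - Im z\<bar>"
    have "y\<^sup>2 \<le> (N * Re z)\<^sup>2" using that by (intro power_mono) (auto simp: y_def)
    then have "y\<^sup>2 * (N\<^sup>2 + 4) \<le> N\<^sup>2 * (4 * (Re z)\<^sup>2 + y\<^sup>2)" by (simp add: algebra_simps power_mult_distrib)
    moreover have "0 < N\<^sup>2 + 4" by (simp add: add_nonneg_pos)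
    ultimately have "y\<^sup>2 \<le> N\<^sup>2 / (N\<^sup>2 + 4) * (4 * (Re z)\<^sup>2 + y\<^sup>2)"
      by (simp add: pos_le_divide_eq)
    moreover have "(cmod (u - z))\<^sup>2 = y\<^sup>2" using that by (simp add: cmod_power2 y_def)
    moreover have "(cmod (u + cnj z))\<^sup>2 = 4 * (Re z)\<^sup>2 + y\<^sup>2"
      unfolding cmod_power2 using that by (simp add: y_def)
    moreover have "k\<^sup>2 = N\<^sup>2 / (N\<^sup>2 + 4)" using \<open>0 < N\<^sup>2 + 4\<close> by (simp add: k_def power_divide)
    ultimately have "(cmod (u - z))\<^sup>2 \<le> (k * cmod (u + cnj z))\<^sup>2" by (simp add: power_mult_distrib)
    then have "cmod (u - z) \<le> k * cmod (u + cnj z)"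
      by (rule power2_le_imp_le) (use k in auto)
    then show ?thesis unfolding q_def using that k by (intro deriv_harnack) auto
  qed
  have "\<exists>l\<in>frontier Om. cmod (l - f z) \<le> C * E z \<and> (Re (f 1) \<le> Re l \<or> Im l \<le> Im (f 1))"
    if z: "0 < Re z" "Im z \<le> N * Re z" for z
  proof (cases "Im z \<le> 0")
    case True
    obtain l where l: "l \<in> frontier Om" "cmod (l - f z) \<le> 2 * cM * E z"
      "Re (f 1) \<le> Re l \<or> Im l \<le> Im (f 1)"
      using frontier_point_below[OF z(1) True] by blast
    have "cM * 1 \<le> cM * q" using q cM_pos by (intro mult_left_mono) auto
    moreover have "0 \<le> q * N" using q N by simp
    ultimately have "2 * cM \<le> C" by (simp add: C_def)
    then have "2 * cM * E z \<le> C * E z" using E_pos[OF z(1)] by (intro mult_right_mono) auto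
    then show ?thesis using l by force
  next
    case False
    define z' where "z' = complex_of_real (Re z)"
    have z': "0 < Re z'" "Im z' \<le> 0" using z by (auto simp: z'_def)
    obtain l where l: "l \<in> frontier Om" "cmod (l - f z') \<le> 2 * cM * E z'"
      "Re (f 1) \<le> Re l \<or> Im l \<le> Im (f 1)"
      using frontier_point_below[OF z'] by blast
    have "cmod (deriv f z') \<le> q * cmod (deriv f z)"
      using z False by (intro vertical) (auto simp: z'_def)
    then have "E z' \<le> q * E z" using z by (simp add: E_def z'_def mult.left_commute mult_left_mono)
    then have 1: "2 * cM * E z' \<le> 2 * cM * (q * E z)" using cM_pos by (intro mult_left_mono) auto
    have seg: "Re u = Re z \<and> \<bar>Im u - Im z\<bar> \<le> N * Re z" if u: "u \<in> closed_segment z' z" for u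
    proof -
      obtain t where t: "0 \<le> t" "t \<le> 1" "u = (1 - t) *\<^sub>R z' + t *\<^sub>R z"
        using u unfolding in_segment by blast
      have "Im u - Im z = - ((1 - t) * Im z)" unfolding t(3) by (simp add: z'_def algebra_simps)
      moreover have "(1 - t) * Im z \<le> 1 * Im z" using t False by (intro mult_right_mono) auto
      moreover have "0 \<le> (1 - t) * Im z" using t False by (intro mult_nonneg_nonneg) auto
      moreover have "Re u = Re z" unfolding t(3) by (simp add: z'_def algebra_simps)
      ultimately show ?thesis using z by linarith
    qed
    have "cmod (f z' - f z) \<le> q * cmod (deriv f z) * cmod (z' - z)"
    proof (rule field_differentiable_bound[of "closed_segment z' z" f "deriv f"])
      fix u assume "u \<in> closed_segment z' z"
      then show "cmod (deriv f u) \<le> q * cmod (deriv f z)" using vertical[OF z(1)] seg by blast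
      show "(f has_field_derivative deriv f u) (at u within closed_segment z' z)"
      proof (rule has_field_derivative_at_within[OF holomorphic_derivI[OF holo open_right_halfplane]])
        show "u \<in> right_halfplane" using seg[OF \<open>u \<in> closed_segment z' z\<close>] z by simp
      qed
    qed auto
    also have "cmod (z' - z) = Im z"
      using False by (simp add: z'_def cmod_def)
    also have "q * cmod (deriv f z) * Im z \<le> q * cmod (deriv f z) * (N * Re z)"
      using z q by (intro mult_left_mono) auto
    finally have 2: "cmod (f z' - f z) \<le> q * N * E z" by (simp add: E_def mult_ac)
    have "cmod (l - f z) \<le> cmod (l - f z') + cmod (f z' - f z)"
      using norm_triangle_ineq[of "l - f z'" "f z' - f z"] by simp
    also have "\<dots> \<le> 2 * cM * (q * E z) + q * N * E z" using l 1 2 by linarith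
    also have "\<dots> \<le> C * E z" using E_pos[OF z(1)] by (simp add: C_def algebra_simps)
    finally show ?thesis using l by blast
  qed
  moreover have "1 \<le> C" using q N cM_pos by (simp add: C_def)
  ultimately show thesis using that by blast
qed

end

subsection \<open>The distances to the two sides of the boundary\<close>

lemma INF_cmod_nonneg: "(0 :: ereal) \<le> (INF z\<in>S. ereal (cmod (z - w)))"
  by (rule INF_greatest) simp

text \<open>\<open>delta_plus\<close> and \<open>delta_minus\<close> are both of this form, with
  different \<open>S\<close>; this and the next two lemmas provide their bounds.\<close>

lemma trunc_dist_le:
  assumes "0 \<le> t"
  shows "real_of_ereal (min (ereal t) (INF z\<in>S. ereal (cmod (z - w)))) \<le> t"
  using real_of_ereal_positive_mono[of "min (ereal t) (INF z\<in>S. ereal (cmod (z - w)))" "ereal t"]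
    INF_cmod_nonneg[where S = S and w = w] assms by auto

lemma trunc_dist_le_cmod:
  assumes "0 \<le> t" "z \<in> S"
  shows "real_of_ereal (min (ereal t) (INF z\<in>S. ereal (cmod (z - w)))) \<le> cmod (z - w)"
proof -
  have "(INF z\<in>S. ereal (cmod (z - w))) \<le> ereal (cmod (z - w))"
    using assms(2) by (rule INF_lower)
  then show ?thesis
    using real_of_ereal_positive_mono[of "min (ereal t) (INF z\<in>S. ereal (cmod (z - w)))"
        "ereal (cmod (z - w))"] INF_cmod_nonneg[where S = S and w = w] assms
    by (auto intro: min.coboundedI2)
qed

lemma trunc_dist_ge:
  assumes "0 \<le> c" "c \<le> t" "\<And>z. z \<in> S \<Longrightarrow> c \<le> cmod (z - w)"
  shows "c \<le> real_of_ereal (min (ereal t) (INF z\<in>S. ereal (cmod (z - w))))"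
proof -
  have "ereal c \<le> (INF z\<in>S. ereal (cmod (z - w)))" by (rule INF_greatest) (use assms in auto)
  moreover have "min (ereal t) (INF z\<in>S. ereal (cmod (z - w))) \<noteq> \<infinity>"
    by (auto simp: min_def)
  ultimately show ?thesis
    using real_of_ereal_positive_mono[of "ereal c" "min (ereal t) (INF z\<in>S. ereal (cmod (z - w)))"] assms
    by auto
qed

section \<open>Comparison of \<open>delta_plus\<close> and \<open>delta_minus\<close> with
  \<open>E\<close>\<close>

context upward_map
begin

lemma frontier_not_in: "b \<in> frontier Om \<Longrightarrow> b \<notin> Om"
  using open_Om by (simp add: frontier_def interior_open)

lemma orbit_in: "0 \<le> t \<Longrightarrow> f 1 + \<i> * of_real t \<in> Om"
  by (rule up_Om) auto

lemma dist_frontier_ge: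
  assumes "w \<in> Om" "b \<in> frontier Om"
  shows "cB * E (F w) \<le> cmod (b - w)"
  using ball_subset_Om[OF Re_F[OF assms(1)]] frontier_not_in[OF assms(2)] assms(1)
  by (auto simp: subset_iff dist_norm norm_minus_commute not_less[symmetric])

lemma delta_ge_E:
  assumes "0 < t"
  defines "w \<equiv> f 1 + \<i> * of_real t"
  shows "min t (cB * E (F w)) \<le> delta_plus Om (f 1) t"
    and "min t (cB * E (F w)) \<le> delta_minus Om (f 1) t"
proof -
  have w: "w \<in> Om" using assms orbit_in by auto
  then have "0 < E (F w)" using E_pos Re_F by blast
  then have "0 \<le> min t (cB * E (F w))" using cB assms by auto
  then show "min t (cB * E (F w)) \<le> delta_plus Om (f 1) t"
    "min t (cB * E (F w)) \<le> delta_minus Om (f 1) t"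
    unfolding delta_plus_def delta_minus_def w_def[symmetric]
    by (intro trunc_dist_ge; use dist_frontier_ge[OF w] in \<open>auto intro: min.coboundedI2\<close>)+
qed

lemma delta_pos:
  assumes "0 < t"
  shows "0 < delta_plus Om (f 1) t" "0 < delta_minus Om (f 1) t"
proof -
  define w where "w = f 1 + \<i> * of_real t"
  have "0 < E (F w)" using E_pos Re_F orbit_in assms by (simp add: w_def)
  then have "0 < min t (cB * E (F w))" using cB assms by auto
  then show "0 < delta_plus Om (f 1) t" "0 < delta_minus Om (f 1) t"
    using delta_ge_E[OF assms] unfolding w_def by linarith+
qed

text \<open>The boundary point from \<open>frontier_point_below_sector\<close> either lies to the
  right of \<open>f 1\<close> and enters the infimum, or lies below \<open>f 1\<close>; then its
  distance is at least \<open>t\<close> and the truncation takes over.\<close>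

lemma delta_plus_le_E:
  assumes "0 \<le> N"
  obtains C where "1 \<le> C" "\<And>t. 0 < t \<Longrightarrow>
    Im (F (f 1 + \<i> * of_real t)) \<le> N * Re (F (f 1 + \<i> * of_real t)) \<Longrightarrow>
    delta_plus Om (f 1) t \<le> C * min t (E (F (f 1 + \<i> * of_real t)))"
proof -
  obtain C where C: "1 \<le> C" "\<And>z. 0 < Re z \<Longrightarrow> Im z \<le> N * Re z \<Longrightarrow>
    \<exists>l\<in>frontier Om. cmod (l - f z) \<le> C * E z \<and> (Re (f 1) \<le> Re l \<or> Im l \<le> Im (f 1))"
    using frontier_point_below_sector[OF assms] by metis
  have "delta_plus Om (f 1) t \<le> C * min t (E (F w))"
    if t: "0 < t" and w_def: "w = f 1 + \<i> * of_real t" and sector: "Im (F w) \<le> N * Re (F w)" for t w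
  proof -
    have w: "w \<in> Om" using t orbit_in by (simp add: w_def)
    have le_t: "delta_plus Om (f 1) t \<le> t"
      unfolding delta_plus_def using t by (intro trunc_dist_le) auto
    obtain l where l: "l \<in> frontier Om" "cmod (l - w) \<le> C * E (F w)"
      "Re (f 1) \<le> Re l \<or> Im l \<le> Im (f 1)"
      using C(2)[of "F w"] Re_F[OF w] sector w by auto
    have "delta_plus Om (f 1) t \<le> cmod (l - w)"
    proof (cases "Re (f 1) \<le> Re l")
      case True
      then show ?thesis
        unfolding delta_plus_def w_def using l t by (intro trunc_dist_le_cmod) auto
    next
      case False
      then have "t \<le> \<bar>Im (l - w)\<bar>" using l by (simp add: w_def)
      then show ?thesis using le_t abs_Im_le_cmod[of "l - w"] by linarith
    qed
    then have "delta_plus Om (f 1) t \<le> C * E (F w)" using l by linarith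
    moreover have "t \<le> C * t" using C t by simp
    then have "delta_plus Om (f 1) t \<le> C * t" using le_t by linarith
    ultimately show ?thesis by (auto simp: min_def)
  qed
  then show thesis using that C(1) by blast
qed

text \<open>Both sides are compared with the minimum of \<open>t\<close> and \<open>E\<close>:
  \<open>delta_plus\<close> from above by the sector condition, \<open>delta_minus\<close> from
  below by \<open>delta_ge_E\<close>.\<close>

lemma delta_plus_le_delta_minus:
  assumes "0 \<le> N"
  obtains C where "0 < C" "\<And>t. 0 < t \<Longrightarrow>
    Im (F (f 1 + \<i> * of_real t)) \<le> N * Re (F (f 1 + \<i> * of_real t)) \<Longrightarrow>
    delta_plus Om (f 1) t \<le> C * delta_minus Om (f 1) t"
proof -
  obtain C where C: "1 \<le> C" "\<And>t. 0 < t \<Longrightarrow>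
    Im (F (f 1 + \<i> * of_real t)) \<le> N * Re (F (f 1 + \<i> * of_real t)) \<Longrightarrow>
    delta_plus Om (f 1) t \<le> C * min t (E (F (f 1 + \<i> * of_real t)))"
    using delta_plus_le_E[OF assms] by metis
  have "delta_plus Om (f 1) t \<le> C / cB * delta_minus Om (f 1) t"
    if t: "0 < t" "Im (F (f 1 + \<i> * of_real t)) \<le> N * Re (F (f 1 + \<i> * of_real t))" for t
  proof -
    define e where "e = E (F (f 1 + \<i> * of_real t))"
    have "0 < e" using E_pos Re_F orbit_in t by (simp add: e_def)
    have "cB * min t e \<le> cB * t" "cB * min t e \<le> cB * e" using cB by (intro mult_left_mono; simp)+
    moreover have "cB * t \<le> t" using cB t by simp
    ultimately have "cB * min t e \<le> min t (cB * e)" by linarith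
    then have "cB * min t e \<le> delta_minus Om (f 1) t"
      using delta_ge_E(2)[OF t(1), folded e_def] by linarith
    then have "min t e \<le> delta_minus Om (f 1) t / cB" using cB by (simp add: pos_le_divide_eq mult.commute)
    then have "C * min t e \<le> C * (delta_minus Om (f 1) t / cB)" using C by (intro mult_left_mono) auto
    then show ?thesis using C(2)[OF t] by (simp add: e_def)
  qed
  moreover have "0 < C / cB" using C(1) cB by simp
  ultimately show thesis using that by blast
qed

text \<open>The harmonic function on \<open>Om\<close> which vanishes on the right part of the boundary.\<close>
definition V :: "complex \<Rightarrow> real" where
  "V w = pi / 2 + Arg (F w)"

text \<open>\<open>V\<close> is the positive real part of the holomorphic function \<open>W\<close>;
  half the radius gives the Harnack factor \<open>(1 + 1/2) / (1 - 1/2) = 3\<close>.\<close>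

lemma V_harnack:
  assumes "ball q r \<subseteq> Om" "0 < r" "cmod (q' - q) \<le> r / 2"
  shows "V q' \<le> 3 * V q"
proof -
  define W where "W = (\<lambda>w. of_real (pi / 2) - \<i> * Ln (F w))"
  have ReF: "0 < Re (F w)" if "w \<in> ball q r" for w using Re_F assms(1) that by blast
  have nz: "F w \<noteq> 0" if "w \<in> ball q r" for w using ReF[OF that] by auto
  have notneg: "F w \<notin> \<real>\<^sub>\<le>\<^sub>0" if "w \<in> ball q r" for w
    using ReF[OF that] by (auto simp: complex_nonpos_Reals_iff)
  have W: "W holomorphic_on ball q r"
    unfolding W_def using notneg
    by (intro holomorphic_intros holomorphic_on_subset[OF F_holo assms(1)]) auto
  have Re_W: "Re (W w) = V w" if "w \<in> ball q r" for w
    using nz[OF that] by (simp add: W_def V_def Arg_eq_Im_Ln)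
  have pos: "0 < Re (W w)" if "w \<in> ball q r" for w
    using Re_W[OF that] ReF[OF that] Arg_Re_pos[of "F w"] by (auto simp: V_def)
  have q': "q' \<in> ball q r" "q \<in> ball q r"
    using assms by (auto simp: dist_norm norm_minus_commute)
  have "cmod (W q' - W q) \<le> 1 / 2 * cmod (W q' + cnj (W q))"
    by (rule schwarz_pick_ball_halfplane[OF W pos]) (use assms in auto)
  then have "Re (W q') \<le> (1 + 1 / 2) / (1 - 1 / 2) * Re (W q)"
    by (rule Re_le_of_pseudo_dist_le) (use pos q' in auto)
  then show ?thesis using Re_W q' by simp
qed

text \<open>If \<open>Im (F u) < 0\<close> for all \<open>u\<close> in \<open>Om\<close> on the
  segment \<open>S\<close> below \<open>q\<close>, difference quotients confine \<open>F u\<close>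
  to a compact box \<open>K\<close>. Then \<open>S \<inter> Om\<close> is clopen in
  \<open>S\<close>, hence all of \<open>S\<close>, although the lower end is not in
  \<open>Om\<close>.\<close>

lemma vertical_exit:
  assumes q: "q \<in> Om" "Re q < Re (f 1)" and \<sigma>: "0 < \<sigma>" "q - \<i> * of_real \<sigma> \<notin> Om"
    and low: "Im (f 1) < Im q - \<sigma>"
  shows "\<exists>b\<in>Om. Re b = Re q \<and> Im q - \<sigma> \<le> Im b \<and> Im b \<le> Im q \<and> 0 \<le> Im (F b)"
proof (rule ccontr)
  assume contra: "\<not> ?thesis"
  define S where "S = closed_segment (q - \<i> * of_real \<sigma>) q"
  have S: "S = {b. Re b = Re q \<and> Im q - \<sigma> \<le> Im b \<and> Im b \<le> Im q}"
    unfolding S_def using \<sigma> by (subst closed_segment_same_Re) (auto simp: closed_segment_eq_real_ivl)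
  define a where "a = Re (f 1) - Re q"
  define e where "e = Im q - Im (f 1)"
  define X where "X = Re (F q)"
  define K where "K = cbox (Complex 1 (- (e * X / a))) (Complex X 0)"
  have a: "0 < a" and e: "0 < e" using assms by (auto simp: a_def e_def)
  have K_sub: "K \<subseteq> right_halfplane" by (auto simp: K_def in_cbox_complex_iff)
  have inK: "u \<in> f ` K" if u: "u \<in> Om" "u \<in> S" for u
  proof -
    define z where "z = F u"
    have z: "0 < Re z" "f z = u" using u Re_F by (auto simp: z_def)
    have Im_z: "Im z < 0" using contra u unfolding S z_def by auto
    have u': "Re u = Re q" "Im q - \<sigma> \<le> Im u" "Im u \<le> Im q" using u unfolding S by auto
    have "Re z \<le> X"
    proof (cases "Im u = Im q")
      case True
      then have "u = q" using u' by (simp add: complex_eq_iff)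
      then show ?thesis by (simp add: X_def z_def)
    next
      case False
      \<comment> \<open>Comparison with \<open>F q\<close>: its image lies vertically above
        \<open>f z\<close>, so \<open>Re z\<close> cannot exceed \<open>X\<close>.\<close>
      have "0 \<le> Im ((f (F q) - f z) * cnj (F q - z))" using noshiro Re_F[OF q(1)] z by blast
      then have "0 \<le> (Im q - Im u) * (X - Re z)" using q z u' by (simp add: X_def)
      moreover have "0 < Im q - Im u" using False u' by simp
      ultimately show ?thesis by (simp add: zero_le_mult_iff)
    qed
    define e' where "e' = Im u - Im (f 1)"
    have e': "0 < e'" "e' \<le> e" using u' low by (auto simp: e'_def e_def)
    \<comment> \<open>Comparison with \<open>1\<close>, whose image lies to the right and below: it
      yields \<open>1 < Re z\<close> and bounds \<open>Im z\<close> from below.\<close>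
    have "0 \<le> Im ((f z - f 1) * cnj (z - 1))" using noshiro[of z 1] z by simp
    then have main: "a * - Im z \<le> e' * (Re z - 1)"
      using z u' by (simp add: a_def e'_def algebra_simps)
    moreover have "0 < a * - Im z" using a Im_z by (intro mult_pos_pos) auto
    ultimately have "0 < e' * (Re z - 1)" by linarith
    then have "1 < Re z" using e' by (simp add: zero_less_mult_iff)
    have "e' * (Re z - 1) \<le> e * X"
      using e' \<open>1 < Re z\<close> \<open>Re z \<le> X\<close> by (intro mult_mono) auto
    then have "- Im z \<le> e * X / a" using main a by (simp add: pos_le_divide_eq mult.commute)
    then have "z \<in> K" using \<open>1 < Re z\<close> \<open>Re z \<le> X\<close> Im_z by (auto simp: K_def in_cbox_complex_iff)
    then show ?thesis using z by blast
  qed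
  have "continuous_on K f"
    using holomorphic_on_imp_continuous_on[OF holo] K_sub by (rule continuous_on_subset)
  then have "compact (f ` K)"
    by (rule compact_continuous_image) (simp add: K_def)
  then have "closed (f ` K)" by (rule compact_imp_closed)
  moreover have "S \<inter> Om = S \<inter> f ` K" using inK K_sub by blast
  ultimately have "closedin (top_of_set S) (S \<inter> Om)" by (metis closedin_closed_Int)
  moreover have "openin (top_of_set S) (S \<inter> Om)" using open_Om by (rule openin_open_Int)
  moreover have "connected S" by (simp add: S_def)
  ultimately have "S \<inter> Om = {} \<or> S \<inter> Om = S" by (simp add: connected_clopen)
  moreover have "q \<in> S" "q - \<i> * of_real \<sigma> \<in> S" by (auto simp: S_def)
  ultimately show False using q(1) \<sigma>(2) by blast
qed

text \<open>\<open>V\<close> stays small along a horizontal path to the left of the orbit point. A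
  small \<open>delta_minus\<close> would provide some \<open>z\<close> with
  \<open>Im z \<ge> 0\<close> and \<open>f z\<close> near the path, and the difference quotient with
  the left end would make \<open>V\<close> large there.\<close>

lemma mult_delta_plus_le_delta_minus:
  assumes C0: "0 < C0"
  obtains \<theta> where "0 < \<theta>" "\<And>t. 0 < t \<Longrightarrow> V (f 1 + \<i> * of_real t) < \<theta> \<Longrightarrow>
    C0 * delta_plus Om (f 1) t \<le> delta_minus Om (f 1) t"
proof -
  obtain cA where cA: "1 \<le> cA"
    and below: "\<And>z. 0 < Re z \<Longrightarrow> Im z \<le> 0 * Re z \<Longrightarrow>
      \<exists>l\<in>frontier Om. cmod (l - f z) \<le> cA * E z \<and> (Re (f 1) \<le> Re l \<or> Im l \<le> Im (f 1))"
    using frontier_point_below_sector[of 0] by auto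
  obtain cD where cD: "1 \<le> cD" and delta_le: "\<And>t. 0 < t \<Longrightarrow>
      Im (F (f 1 + \<i> * of_real t)) \<le> 0 * Re (F (f 1 + \<i> * of_real t)) \<Longrightarrow>
      delta_plus Om (f 1) t \<le> cD * min t (E (F (f 1 + \<i> * of_real t)))"
    using delta_plus_le_E[of 0] by auto
  \<comment> \<open>Since \<open>delta_plus\<close> is at most \<open>cD * e\<close>, it suffices to
    show \<open>C * e \<le> delta_minus\<close>, with \<open>e\<close> defined below.\<close>
  define C where "C = C0 * cD"
  \<comment> \<open>In units of \<open>e\<close>, the radius of discs inside \<open>Om\<close> along
    the path: one \<open>cB\<close> comes from the horizontal gap \<open>cB * e / 2\<close>, the
    other from \<open>ball_subset_Om\<close>.\<close>
  define \<rho> where "\<rho> = cB * cB / (2 * cA)"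
  have "0 < C" using C0 cD by (simp add: C_def)
  have "0 < \<rho>" using cB cA by (simp add: \<rho>_def)
  have "cB * cB \<le> cB * cA" using cB cA by (intro mult_left_mono) auto
  then have "\<rho> \<le> cB / 2" using cA by (simp add: \<rho>_def divide_simps)
  \<comment> \<open>Enough steps of length \<open>\<rho> * e / 2\<close> to cover
    \<open>(C + 1) * e\<close>.\<close>
  obtain n where n: "2 * (C + 1) / \<rho> \<le> real n" using real_arch_simple by blast
  \<comment> \<open>For \<open>u\<close> in \<open>Om\<close>, \<open>V u < \<theta>0\<close> says
    that the slope \<open>Im / Re\<close> of \<open>F u\<close> is below \<open>- C\<close>.\<close>
  define \<theta>0 where "\<theta>0 = pi / 2 - arctan C"
  have \<theta>0: "0 < \<theta>0" "\<theta>0 \<le> pi / 2"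
    using arctan_ubound[of C] \<open>0 < C\<close> by (auto simp: \<theta>0_def)
  \<comment> \<open>Each of the \<open>n\<close> Harnack steps may triple \<open>V\<close>.\<close>
  define \<theta> where "\<theta> = \<theta>0 / 3 ^ n"
  have "C0 * delta_plus Om (f 1) t \<le> delta_minus Om (f 1) t"
    if t: "0 < t" and V_small: "V (f 1 + \<i> * of_real t) < \<theta>" for t
  proof -
    define w where "w = f 1 + \<i> * of_real t"
    have w: "w \<in> Om" using t orbit_in by (simp add: w_def)
    define e where "e = min t (E (F w))"
    have e: "0 < e" "e \<le> t" "e \<le> E (F w)"
      using t E_pos Re_F[OF w] by (auto simp: e_def)
    define s where "s = \<rho> * e / 2"
    have "0 < s" using \<open>0 < \<rho>\<close> e by (simp add: s_def)
    have V_Im: "Im (F u) < 0" if "u \<in> Om" "V u < pi / 2" for u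
    proof -
      have "arctan (Im (F u) / Re (F u)) < 0"
        using that arg_conv_arctan[OF Re_F[OF that(1)]] by (simp add: V_def)
      then show ?thesis using Re_F[OF that(1)] by (simp add: divide_less_0_iff)
    qed
    have V_nonneg: "0 < V u" if "u \<in> Om" for u
      using Arg_Re_pos[of "F u"] Re_F[OF that] by (auto simp: V_def)
    have V_pow: "3 ^ k * V w < \<theta>0" if "k \<le> n" for k
    proof -
      have "(3 :: real) ^ k * V w \<le> 3 ^ n * V w"
        using that V_nonneg[OF w] by (intro mult_right_mono power_increasing) auto
      also have "\<dots> < \<theta>0" using V_small by (simp add: \<theta>_def w_def field_simps)
      finally show ?thesis .
    qed
    have chain: "ball (w - of_real (real k * s)) (\<rho> * e) \<subseteq> Om \<and>
        V (w - of_real (real k * s)) \<le> 3 ^ k * V w" if "k \<le> n" for k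
      using that
    proof (induction k)
      case 0
      have "\<rho> * e \<le> cB * E (F w)"
        using \<open>\<rho> \<le> cB / 2\<close> \<open>0 < \<rho>\<close> cB e by (intro mult_mono) auto
      then have "ball w (\<rho> * e) \<subseteq> Om"
        using ball_subset_Om[OF Re_F[OF w]] w by (auto simp: subset_iff)
      then show ?case by simp
    next
      case (Suc k)
      define q where "q = w - of_real (real k * s)"
      define \<tau> where "\<tau> = real (Suc k) * s"
      define q' where "q' = w - of_real \<tau>"
      have IH: "ball q (\<rho> * e) \<subseteq> Om" "V q \<le> 3 ^ k * V w" using Suc by (auto simp: q_def)
      have "q' - q = - of_real s" by (simp add: q_def q'_def \<tau>_def algebra_simps)
      then have d: "cmod (q' - q) = s" using \<open>0 < s\<close> by simp
      have re: "0 < \<rho> * e" using \<open>0 < \<rho>\<close> e by simp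
      have V': "V q' \<le> 3 * V q"
        by (rule V_harnack[OF IH(1) re]) (simp add: d s_def)
      then have V'': "V q' \<le> 3 ^ Suc k * V w" using IH by simp
      have q'_in: "q' \<in> Om"
        using IH(1) d re by (auto simp: subset_iff dist_norm norm_minus_commute s_def)
      have "ball q' (\<rho> * e) \<subseteq> Om"
      \<comment> \<open>Near \<open>w\<close> the disc from \<open>ball_subset_Om\<close> at
        \<open>w\<close> suffices. Farther left, the boundary point supplied by \<open>below\<close>
        is at least \<open>cB * e / 2\<close> away, so \<open>E (F q')\<close> is not small and the
        disc at \<open>q'\<close> suffices.\<close>
      proof (cases "\<tau> \<le> cB * e / 2")
        case True
        have "ball q' (\<rho> * e) \<subseteq> ball w (cB * e)"
        proof
          fix u assume "u \<in> ball q' (\<rho> * e)"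
          then have "dist q' u < \<rho> * e" by simp
          also have "\<rho> * e \<le> cB / 2 * e" using \<open>\<rho> \<le> cB / 2\<close> e by (intro mult_right_mono) auto
          finally have "dist q' u < cB * e / 2" by simp
          moreover have "0 \<le> \<tau>" using \<open>0 < s\<close> by (simp add: \<tau>_def)
          then have "dist w q' = \<tau>" by (simp add: q'_def dist_norm)
          ultimately show "u \<in> ball w (cB * e)"
            using True dist_triangle[of w u q'] by simp
        qed
        also have "\<dots> \<subseteq> ball w (cB * E (F w))" using cB e by (intro subset_ball mult_left_mono) auto
        also have "\<dots> \<subseteq> Om" using ball_subset_Om[OF Re_F[OF w]] w by simp
        finally show ?thesis .
      next
        case False
        have "Im (F q') < 0"
          using V_Im[OF q'_in] V'' V_pow[OF Suc.prems] \<theta>0 by linarith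
        then obtain l where l: "l \<in> frontier Om" "cmod (l - q') \<le> cA * E (F q')"
          "Re (f 1) \<le> Re l \<or> Im l \<le> Im (f 1)"
          using below[OF Re_F[OF q'_in]] q'_in by auto
        have "cB * e \<le> 1 * e" using cB e by (intro mult_right_mono) auto
        then have "cB * e / 2 \<le> t" using e by linarith
        have "cB * e / 2 \<le> cmod (l - q')"
        proof (cases "Re (f 1) \<le> Re l")
          case True
          moreover have "Re (l - q') = Re l - Re (f 1) + \<tau>" by (simp add: q'_def w_def)
          ultimately have "cB * e / 2 \<le> \<bar>Re (l - q')\<bar>" using False by linarith
          then show ?thesis using abs_Re_le_cmod[of "l - q'"] by linarith
        next
          case False
          then have "Im l \<le> Im (f 1)" using l by blast
          moreover have "Im (l - q') = Im l - Im (f 1) - t" by (simp add: q'_def w_def)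
          ultimately have "cB * e / 2 \<le> \<bar>Im (l - q')\<bar>" using \<open>cB * e / 2 \<le> t\<close> by linarith
          then show ?thesis using abs_Im_le_cmod[of "l - q'"] by linarith
        qed
        then have "cB * (cB * e / 2) \<le> cB * (cA * E (F q'))" using l cB by (intro mult_left_mono) auto
        then have "\<rho> * e \<le> cB * E (F q')" using cA by (simp add: \<rho>_def field_simps)
        then have "ball q' (\<rho> * e) \<subseteq> ball q' (cB * E (F q'))" by (rule subset_ball)
        also have "\<dots> \<subseteq> Om" using ball_subset_Om[OF Re_F[OF q'_in]] q'_in by simp
        finally show ?thesis .
      qed
      then show ?case using V'' by (simp only: q'_def \<tau>_def)
    qed
    have on_path: "w - of_real \<tau> \<in> Om" if "0 \<le> \<tau>" "\<tau> \<le> real n * s" for \<tau>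
    proof -
      \<comment> \<open>The nearest grid point at or to the right; it is less than \<open>s\<close>,
        half the disc radius, away.\<close>
      define k where "k = nat \<lfloor>\<tau> / s\<rfloor>"
      have k: "real k * s \<le> \<tau>" "\<tau> < real k * s + s"
      proof -
        have "0 \<le> \<tau> / s" using that \<open>0 < s\<close> by simp
        then have "real k \<le> \<tau> / s" "\<tau> / s < real k + 1" by (auto simp: k_def)
        then show "real k * s \<le> \<tau>" "\<tau> < real k * s + s"
          using \<open>0 < s\<close> by (simp_all add: pos_le_divide_eq pos_divide_less_eq distrib_right)
      qed
      have "real k * s \<le> real n * s" using k that by linarith
      then have "k \<le> n" using \<open>0 < s\<close> by simp
      moreover have "w - of_real \<tau> \<in> ball (w - of_real (real k * s)) (\<rho> * e)"
      proof -
        have "dist (w - of_real (real k * s)) (w - of_real \<tau>) = \<bar>\<tau> - real k * s\<bar>"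
          by (simp add: dist_norm flip: of_real_mult of_real_diff norm_of_real)
             (metis norm_of_real of_real_diff of_real_mult of_real_of_nat_eq)
        then show ?thesis using k \<open>0 < s\<close> by (simp add: s_def)
      qed
      ultimately show ?thesis using chain by blast
    qed
    have ns: "(C + 1) * e \<le> real n * s"
    proof -
      have "2 * (C + 1) \<le> real n * \<rho>" using n \<open>0 < \<rho>\<close> by (simp add: pos_divide_le_eq)
      then have "2 * (C + 1) * e \<le> real n * \<rho> * e" using e by (intro mult_right_mono) auto
      then show ?thesis by (simp add: s_def algebra_simps)
    qed
    have "C * e \<le> delta_minus Om (f 1) t"
    proof (rule ccontr)
      assume contra: "\<not> ?thesis"
      have "t < C * e \<or> (\<exists>b\<in>frontier Om. Re b \<le> Re (f 1) \<and> cmod (b - w) < C * e)"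
      proof (rule ccontr)
        assume "\<not> ?thesis"
        then have "C * e \<le> delta_minus Om (f 1) t"
          unfolding delta_minus_def w_def using \<open>0 < C\<close> e by (intro trunc_dist_ge) auto
        then show False using contra by simp
      qed
      then consider "t < C * e"
        | b where "b \<in> frontier Om" "Re b \<le> Re (f 1)" "cmod (b - w) < C * e" "C * e \<le> t"
        by force
      \<comment> \<open>For small \<open>t\<close> the point \<open>1\<close> serves. Otherwise a
        near boundary point \<open>b\<close> lies below the path, and \<open>vertical_exit\<close>
        finds a suitable image point between them.\<close>
      then have "\<exists>z. 0 < Re z \<and> 0 \<le> Im z \<and> Re w - C * e < Re (f z) \<and>
          0 \<le> Im w - Im (f z) \<and> Im w - Im (f z) \<le> C * e"
      proof cases
        case 1
        then show ?thesis using t by (intro exI[of _ 1]) (auto simp: w_def)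
      next
        case 2
        define \<tau> where "\<tau> = Re w - Re b"
        define q where "q = w - of_real \<tau>"
        define \<sigma> where "\<sigma> = Im w - Im b"
        have b_eq: "b = q - \<i> * of_real \<sigma>" by (simp add: complex_eq_iff q_def \<tau>_def \<sigma>_def)
        have b: "b \<notin> Om" using 2 frontier_not_in by blast
        have \<tau>: "0 \<le> \<tau>" "\<tau> < C * e"
          using 2 abs_Re_le_cmod[of "b - w"] by (auto simp: \<tau>_def w_def)
        have \<sigma>_lt: "\<sigma> < C * e" using 2 abs_Im_le_cmod[of "b - w"] by (simp add: \<sigma>_def)
        have "C * e \<le> (C + 1) * e" using e by simp
        then have q: "q \<in> Om" unfolding q_def using \<tau> ns by (intro on_path) linarith+
        \<comment> \<open>Otherwise \<open>b\<close> would lie on the upward ray from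
          \<open>q\<close>, which stays in \<open>Om\<close>.\<close>
        have "0 < \<sigma>"
        proof (rule ccontr)
          assume "\<not> 0 < \<sigma>"
          then have "q + \<i> * of_real (- \<sigma>) \<in> Om" using q by (intro up_Om) auto
          then show False using b b_eq by simp
        qed
        \<comment> \<open>Otherwise \<open>b\<close> would lie on the orbit;
          \<open>vertical_exit\<close> needs \<open>q\<close> strictly to the left of
          \<open>f 1\<close>.\<close>
        have "\<tau> \<noteq> 0"
        proof
          assume "\<tau> = 0"
          then have "b = f 1 + \<i> * of_real (t - \<sigma>)" by (simp add: b_eq q_def w_def algebra_simps)
          moreover have "0 \<le> t - \<sigma>" using \<sigma>_lt 2 by linarith
          ultimately show False using b orbit_in by metis
        qed
        then have "\<exists>b'\<in>Om. Re b' = Re q \<and> Im q - \<sigma> \<le> Im b' \<and> Im b' \<le> Im q \<and> 0 \<le> Im (F b')"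
          using q \<tau> \<open>0 < \<sigma>\<close> b b_eq \<sigma>_lt 2 by (intro vertical_exit) (auto simp: q_def w_def)
        then obtain b' where b': "b' \<in> Om" "Re b' = Re q" "Im q - \<sigma> \<le> Im b'" "Im b' \<le> Im q"
          "0 \<le> Im (F b')" by blast
        show ?thesis
          using b' \<tau> \<sigma>_lt Re_F[OF b'(1)] by (intro exI[of _ "F b'"]) (auto simp: q_def)
      qed
      then obtain z where z: "0 < Re z" "0 \<le> Im z" "Re w - C * e < Re (f z)"
        "0 \<le> Im w - Im (f z)" "Im w - Im (f z) \<le> C * e" by blast
      define q where "q = w - of_real (real n * s)"
      define X where "X = Re (F q)"
      define Y where "Y = Im (F q)"
      define a where "a = Re (f z) - Re q"
      define d where "d = Im w - Im (f z)"
      have q: "q \<in> Om" unfolding q_def using \<open>0 < s\<close> by (intro on_path) auto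
      have X: "0 < X" using Re_F[OF q] by (simp add: X_def)
      have Vq: "V q < \<theta>0" using chain[of n] V_pow[of n] by (simp add: q_def)
      then have Y: "Y < 0" using V_Im[OF q] \<theta>0 by (simp add: Y_def)
      \<comment> \<open>The extra length \<open>e\<close> of the path separates its left end from
        \<open>f z\<close> horizontally, so that \<open>d \<le> C * a\<close>.\<close>
      have a: "e < a" using ns z by (simp add: a_def q_def algebra_simps)
      have "0 \<le> Im ((f (F q) - f z) * cnj (F q - z))" using noshiro z Re_F[OF q] by blast
      then have "0 \<le> d * (X - Re z) + a * (Y - Im z)"
        using q by (simp add: X_def Y_def a_def d_def q_def algebra_simps)
      moreover have "d * (X - Re z) \<le> d * X" using z by (intro mult_left_mono) (auto simp: d_def)
      moreover have "d * X \<le> (C * a) * X"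
      proof -
        have "C * e \<le> C * a" using a \<open>0 < C\<close> by (intro mult_left_mono) auto
        then have "d \<le> C * a" using z by (simp add: d_def)
        then show ?thesis using X by (intro mult_right_mono) auto
      qed
      moreover have "a * (Y - Im z) \<le> a * Y" using a e z by (intro mult_left_mono) auto
      ultimately have "0 \<le> a * (C * X + Y)" by (simp add: algebra_simps)
      then have "0 \<le> C * X + Y" using a e by (simp add: zero_le_mult_iff)
      then have "- C \<le> Y / X" using X by (simp add: pos_le_divide_eq)
      then have "arctan (- C) \<le> arctan (Y / X)" by (rule arctan_monotone')
      then have "- arctan C \<le> Arg (F q)"
        using arg_conv_arctan[OF Re_F[OF q]] by (simp add: X_def Y_def arctan_minus)
      then show False using Vq by (simp add: V_def \<theta>0_def)
    qed
    moreover have "delta_plus Om (f 1) t \<le> cD * e"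
    proof -
      have "Im (F w) < 0" using V_Im[OF w] V_pow[of 0] \<theta>0 by simp
      then show ?thesis using delta_le[OF t] by (simp add: e_def w_def)
    qed
    then have "C0 * delta_plus Om (f 1) t \<le> C * e"
      using C0 by (simp add: C_def mult.assoc mult_left_mono)
    ultimately show ?thesis by linarith
  qed
  moreover have "0 < \<theta>" using \<theta>0 by (simp add: \<theta>_def)
  ultimately show thesis using that by blast
qed

end

subsection \<open>Reflection and the asymptotic equivalence\<close>

abbreviation mirror :: "complex \<Rightarrow> complex" where
  "mirror z \<equiv> - cnj z"

lemma frontier_mirror: "frontier (mirror ` S) = mirror ` frontier S"
proof -
  have lin: "linear mirror" by (intro linearI) (auto simp: scaleR_conv_of_real)
  have inj: "inj mirror" by (auto intro!: injI)
  show ?thesis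
    unfolding frontier_def closure_injective_linear_image[OF lin inj, symmetric]
      interior_injective_linear_image[OF lin inj] image_set_diff[OF inj] ..
qed

lemma cmod_mirror_diff: "cmod (mirror z - (mirror p + \<i> * of_real t)) = cmod (z - (p + \<i> * of_real t))"
proof -
  have "mirror z - (mirror p + \<i> * of_real t) = mirror (z - (p + \<i> * of_real t))" by simp
  then show ?thesis by (metis complex_mod_cnj norm_minus_cancel)
qed

lemma delta_plus_mirror: "delta_plus (mirror ` S) (mirror p) t = delta_minus S p t"
proof -
  have "{z \<in> frontier (mirror ` S). Re (mirror p) \<le> Re z} = mirror ` {z \<in> frontier S. Re z \<le> Re p}"
    by (auto simp: frontier_mirror)
  then show ?thesis
    by (simp only: delta_plus_def delta_minus_def image_image cmod_mirror_diff)
qed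

lemma delta_minus_mirror: "delta_minus (mirror ` S) (mirror p) t = delta_plus S p t"
  using delta_plus_mirror[of "mirror ` S" "mirror p" t] by (simp add: image_image)

lemma less_neg_tan_iff_arctan_less: "x < - tan y \<longleftrightarrow> arctan x < - y" if "0 < y" "y < pi / 2" for x y :: real
proof -
  have "arctan (- tan y) = - y" using that by (simp add: arctan_minus arctan_tan)
  then show ?thesis using arctan_less_iff[of x "- tan y"] by simp
qed

context upward_map
begin

text \<open>Reflecting both image and half-plane keeps the map holomorphic. Left and right are
  swapped, while imaginary parts, and so the sign of \<open>Im f'\<close>, are kept.\<close>

lemma mirror_upward_map: "upward_map (\<lambda>z. mirror (f (cnj z)))"
proof
  have der: "((\<lambda>z. mirror (f (cnj z))) has_field_derivative mirror (deriv f (cnj z))) (at z)"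
    if "0 < Re z" for z
  proof -
    have "(f has_field_derivative deriv f (cnj z)) (at (cnj z))"
      using holo open_right_halfplane that by (intro holomorphic_derivI) auto
    then have "(cnj \<circ> f \<circ> cnj has_field_derivative cnj (deriv f (cnj z))) (at z)"
      by (rule has_field_derivative_cnj_cnj)
    from DERIV_minus[OF this] show ?thesis by (simp add: o_def)
  qed
  then show "(\<lambda>z. mirror (f (cnj z))) holomorphic_on right_halfplane"
    using open_right_halfplane by (auto simp: holomorphic_on_open)
  show "0 \<le> Im (deriv (\<lambda>z. mirror (f (cnj z))) z)" if "0 < Re z" for z
    using DERIV_imp_deriv[OF der[OF that]] Im_deriv_nonneg[of "cnj z"] that by simp
  show "inj_on (\<lambda>z. mirror (f (cnj z))) right_halfplane"
  proof (rule inj_onI)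
    fix x y assume "x \<in> right_halfplane" "y \<in> right_halfplane" "mirror (f (cnj x)) = mirror (f (cnj y))"
    then have "cnj x = cnj y" by (intro inj_onD[OF inj, of "cnj x" "cnj y"]) auto
    then show "x = y" by simp
  qed
  fix z :: complex and t :: real assume "0 < Re z" "0 \<le> t"
  then obtain u where u: "0 < Re u" "f (cnj z) + \<i> * of_real t = f u" using up[of "cnj z" t] by auto
  have "mirror (f (cnj z)) + \<i> * of_real t = mirror (f (cnj z) + \<i> * of_real t)" by simp
  also have "\<dots> = mirror (f (cnj (cnj u)))" by (simp only: u complex_cnj_cnj)
  finally show "mirror (f (cnj z)) + \<i> * of_real t \<in> (\<lambda>z. mirror (f (cnj z))) ` right_halfplane"
    using u(1) by (intro image_eqI[of _ _ "cnj u"]) auto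
qed

lemma mirror_image: "(\<lambda>z. mirror (f (cnj z))) ` right_halfplane = mirror ` Om"
proof -
  have "cnj ` right_halfplane = right_halfplane"
  proof
    show "right_halfplane \<subseteq> cnj ` right_halfplane"
      by (rule subsetI, rule image_eqI[of _ cnj "cnj _"]) auto
  qed auto
  moreover have "(\<lambda>z. mirror (f (cnj z))) ` right_halfplane = mirror ` f ` cnj ` right_halfplane"
    by (simp only: image_image)
  ultimately show ?thesis by simp
qed

lemma mirror_F:
  assumes "0 \<le> t"
  shows "upward_map.F (\<lambda>z. mirror (f (cnj z))) (mirror (f (cnj 1)) + \<i> * of_real t)
    = cnj (F (f 1 + \<i> * of_real t))"
proof -
  interpret m: upward_map "\<lambda>z. mirror (f (cnj z))" by (rule mirror_upward_map)
  define z where "z = F (f 1 + \<i> * of_real t)"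
  have z: "0 < Re z" "f z = f 1 + \<i> * of_real t"
    using orbit_in[OF assms] Re_F by (auto simp: z_def)
  have "mirror (f (cnj 1)) + \<i> * of_real t = mirror (f (cnj (cnj z)))" by (simp add: z)
  then show ?thesis using m.F_f[of "cnj z"] z(1) by (simp add: z_def)
qed

lemma delta_minus_le_delta_plus:
  assumes "0 \<le> N"
  obtains C where "0 < C" "\<And>t. 0 < t \<Longrightarrow>
    - N * Re (F (f 1 + \<i> * of_real t)) \<le> Im (F (f 1 + \<i> * of_real t)) \<Longrightarrow>
    delta_minus Om (f 1) t \<le> C * delta_plus Om (f 1) t"
proof -
  interpret m: upward_map "\<lambda>z. mirror (f (cnj z))" by (rule mirror_upward_map)
  obtain C where C: "0 < C" and le: "\<And>t. 0 < t \<Longrightarrow>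
    Im (m.F (mirror (f (cnj 1)) + \<i> * of_real t)) \<le> N * Re (m.F (mirror (f (cnj 1)) + \<i> * of_real t)) \<Longrightarrow>
    delta_plus m.Om (mirror (f (cnj 1))) t \<le> C * delta_minus m.Om (mirror (f (cnj 1))) t"
    using m.delta_plus_le_delta_minus[OF assms] by metis
  have "delta_minus Om (f 1) t \<le> C * delta_plus Om (f 1) t"
    if "0 < t" "- N * Re (F (f 1 + \<i> * of_real t)) \<le> Im (F (f 1 + \<i> * of_real t))" for t
    using le[OF that(1)] that
    by (simp add: mirror_F[simplified] mirror_image delta_plus_mirror delta_minus_mirror)
  with C show thesis using that by blast
qed

text \<open>Forward, \<open>mult_delta_plus_le_delta_minus\<close> allows any factor. Backward, a
  ratio below \<open>1 / C\<close> excludes the sector where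
  \<open>delta_minus_le_delta_plus\<close> holds, forcing \<open>Arg\<close> below
  \<open>- \<eta>\<close>.\<close>

lemma Arg_orbit_tendsto_neg_iff:
  "((\<lambda>t. Arg (F (f 1 + \<i> * of_real t))) \<longlongrightarrow> - pi / 2) at_top \<longleftrightarrow>
   ((\<lambda>t. delta_plus Om (f 1) t / delta_minus Om (f 1) t) \<longlongrightarrow> 0) at_top"
proof
  define \<zeta> where "\<zeta> = (\<lambda>t. F (f 1 + \<i> * of_real t))"
  assume "((\<lambda>t. Arg (F (f 1 + \<i> * of_real t))) \<longlongrightarrow> - pi / 2) at_top"
  then have lim: "((\<lambda>t. V (f 1 + \<i> * of_real t)) \<longlongrightarrow> 0) at_top"
    unfolding V_def using tendsto_add[OF tendsto_const, of _ "- pi / 2" at_top "pi / 2"] by auto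
  show "((\<lambda>t. delta_plus Om (f 1) t / delta_minus Om (f 1) t) \<longlongrightarrow> 0) at_top"
  proof (rule tendstoI)
    fix \<epsilon> :: real assume \<epsilon>: "0 < \<epsilon>"
    \<comment> \<open>The factor \<open>2\<close> leaves room for the strict inequality at the
      end.\<close>
    then obtain \<theta> where \<theta>: "0 < \<theta>" "\<And>t. 0 < t \<Longrightarrow> V (f 1 + \<i> * of_real t) < \<theta> \<Longrightarrow>
        2 / \<epsilon> * delta_plus Om (f 1) t \<le> delta_minus Om (f 1) t"
      using mult_delta_plus_le_delta_minus[of "2 / \<epsilon>"] by auto
    have "\<forall>\<^sub>F t in at_top. V (f 1 + \<i> * of_real t) < \<theta>" using order_tendstoD(2)[OF lim] \<theta> by simp
    then show "\<forall>\<^sub>F t in at_top. dist (delta_plus Om (f 1) t / delta_minus Om (f 1) t) 0 < \<epsilon>"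
      using eventually_gt_at_top[of 0]
    proof eventually_elim
      case (elim t)
      have p: "0 < delta_plus Om (f 1) t" "0 < delta_minus Om (f 1) t" using delta_pos elim by auto
      have "2 * delta_plus Om (f 1) t \<le> \<epsilon> * delta_minus Om (f 1) t"
        using \<theta>(2)[of t] elim \<epsilon> by (simp add: field_simps)
      then have "delta_plus Om (f 1) t < \<epsilon> * delta_minus Om (f 1) t" using p by linarith
      then show ?case using p by (simp add: pos_divide_less_eq)
    qed
  qed
next
  assume lim: "((\<lambda>t. delta_plus Om (f 1) t / delta_minus Om (f 1) t) \<longlongrightarrow> 0) at_top"
  show "((\<lambda>t. Arg (F (f 1 + \<i> * of_real t))) \<longlongrightarrow> - pi / 2) at_top"
  proof (rule tendstoI)
    fix \<epsilon> :: real assume \<epsilon>: "0 < \<epsilon>"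
    \<comment> \<open>\<open>min \<epsilon> 1\<close> keeps \<open>\<eta>\<close> in the range where
      \<open>tan\<close> is positive, also for large \<open>\<epsilon>\<close>.\<close>
    define \<eta> where "\<eta> = pi / 2 - min \<epsilon> 1"
    have \<eta>: "0 < \<eta>" "\<eta> < pi / 2" using \<epsilon> pi_gt3 by (auto simp: \<eta>_def)
    then have "0 \<le> tan \<eta>" using tan_gt_zero by fastforce
    then obtain C where C: "0 < C" "\<And>t. 0 < t \<Longrightarrow>
      - tan \<eta> * Re (F (f 1 + \<i> * of_real t)) \<le> Im (F (f 1 + \<i> * of_real t)) \<Longrightarrow>
      delta_minus Om (f 1) t \<le> C * delta_plus Om (f 1) t"
      using delta_minus_le_delta_plus by metis
    have "\<forall>\<^sub>F t in at_top. delta_plus Om (f 1) t / delta_minus Om (f 1) t < 1 / C"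
      using order_tendstoD(2)[OF lim] C(1) by simp
    then show "\<forall>\<^sub>F t in at_top. dist (Arg (F (f 1 + \<i> * of_real t))) (- pi / 2) < \<epsilon>"
      using eventually_gt_at_top[of 0]
    proof eventually_elim
      case (elim t)
      define z where "z = F (f 1 + \<i> * of_real t)"
      have z: "0 < Re z" unfolding z_def using orbit_in[of t] elim Re_F by auto
      have "C * delta_plus Om (f 1) t < delta_minus Om (f 1) t"
        using elim C(1) delta_pos[of t] by (simp add: field_simps)
      then have "Im z < - tan \<eta> * Re z" using C(2)[of t] elim by (force simp: z_def)
      then have "Im z / Re z < - tan \<eta>" using z by (simp add: pos_divide_less_eq)
      then have "Arg z < - \<eta>" using less_neg_tan_iff_arctan_less[OF \<eta>] arg_conv_arctan[OF z] by simp
      moreover have "- pi / 2 < Arg z" using Arg_Re_pos[of z] z by auto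
      ultimately show ?case unfolding z_def[symmetric] by (simp add: dist_real_def \<eta>_def)
    qed
  qed
qed

text \<open>Reflection negates the argument and inverts the ratio; since the ratio is positive, it
  tends to \<open>0\<close> exactly when its inverse tends to infinity.\<close>

lemma Arg_orbit_tendsto_pos_iff:
  "((\<lambda>t. Arg (F (f 1 + \<i> * of_real t))) \<longlongrightarrow> pi / 2) at_top \<longleftrightarrow>
   filterlim (\<lambda>t. delta_plus Om (f 1) t / delta_minus Om (f 1) t) at_top at_top"
proof -
  interpret m: upward_map "\<lambda>z. mirror (f (cnj z))" by (rule mirror_upward_map)
  have ev: "\<forall>\<^sub>F t in at_top. Arg (m.F (mirror (f (cnj 1)) + \<i> * of_real t))
      = - Arg (F (f 1 + \<i> * of_real t))"
    using eventually_ge_at_top[of 0]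
  proof eventually_elim
    case (elim t)
    have "0 < Re (F (f 1 + \<i> * of_real t))" using Re_F orbit_in elim by blast
    then show ?case
      unfolding mirror_F[OF elim] by (simp add: arg_conv_arctan flip: arctan_minus)
  qed
  have "((\<lambda>t. Arg (F (f 1 + \<i> * of_real t))) \<longlongrightarrow> pi / 2) at_top \<longleftrightarrow>
      ((\<lambda>t. - Arg (F (f 1 + \<i> * of_real t))) \<longlongrightarrow> - pi / 2) at_top"
    using tendsto_minus_cancel_left[of "\<lambda>t. - Arg (F (f 1 + \<i> * of_real t))" "pi / 2" at_top] by simp
  also have "\<dots> \<longleftrightarrow> ((\<lambda>t. Arg (m.F (mirror (f (cnj 1)) + \<i> * of_real t))) \<longlongrightarrow> - pi / 2) at_top"
    using filterlim_cong[OF refl refl ev] by blast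
  also have "\<dots> \<longleftrightarrow> ((\<lambda>t. delta_minus Om (f 1) t / delta_plus Om (f 1) t) \<longlongrightarrow> 0) at_top"
    unfolding m.Arg_orbit_tendsto_neg_iff
    by (simp add: mirror_image delta_plus_mirror delta_minus_mirror)
  also have "\<dots> \<longleftrightarrow> filterlim (\<lambda>t. inverse (delta_minus Om (f 1) t / delta_plus Om (f 1) t)) at_top at_top"
    using delta_pos by (intro filterlim_inverse_at_top_iff[symmetric])
      (auto intro: eventually_mono[OF eventually_gt_at_top[of 0]])
  finally show ?thesis by simp
qed

end

subsection \<open>Transfer to the disc\<close>

text \<open>Write \<open>G + b = G * (1 + b / G)\<close>: the second factor tends to
  \<open>1\<close>, and arguments add as both are eventually below \<open>pi / 2\<close> in modulus.
  This absorbs the translation in the charts.\<close>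

lemma Arg_add_const_tendsto_iff:
  fixes G :: "'a \<Rightarrow> complex"
  assumes inf: "filterlim G at_infinity A" and G: "\<forall>\<^sub>F t in A. 0 < Re (G t)"
  shows "((\<lambda>t. Arg (G t + b)) \<longlongrightarrow> l) A \<longleftrightarrow> ((\<lambda>t. Arg (G t)) \<longlongrightarrow> l) A"
proof -
  have "((\<lambda>t. 1 + b * inverse (G t)) \<longlongrightarrow> 1 + b * 0) A"
    by (intro tendsto_intros filterlim_compose[OF tendsto_inverse_0 inf])
  then have "((\<lambda>t. Arg (1 + b * inverse (G t))) \<longlongrightarrow> Arg 1) A"
    using continuous_at_Arg[of 1] by (intro isCont_tendsto_compose[of 1 Arg]) auto
  then have lim: "((\<lambda>t. Arg (1 + b * inverse (G t))) \<longlongrightarrow> 0) A" by simp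
  have "\<forall>\<^sub>F t in A. \<bar>Arg (1 + b * inverse (G t))\<bar> < pi / 2"
    using order_tendstoD(2)[OF tendsto_rabs_zero[OF lim], of "pi / 2"] by simp
  moreover have "((\<lambda>t. 1 + b * inverse (G t)) \<longlongrightarrow> 1) A"
    using \<open>((\<lambda>t. 1 + b * inverse (G t)) \<longlongrightarrow> 1 + b * 0) A\<close> by simp
  then have "\<forall>\<^sub>F t in A. 1 + b * inverse (G t) \<noteq> 0"
    by (rule tendsto_imp_eventually_ne) simp
  ultimately have ev: "\<forall>\<^sub>F t in A. Arg (G t + b) = Arg (G t) + Arg (1 + b * inverse (G t))"
    using G
  proof eventually_elim
    case (elim t)
    have nz: "G t \<noteq> 0" using elim by auto
    have "\<bar>Arg (G t)\<bar> < pi / 2" using elim Arg_Re_pos by blast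
    then have "Arg (G t * (1 + b * inverse (G t))) = Arg (G t) + Arg (1 + b * inverse (G t))"
      using elim nz by (intro Arg_times) auto
    moreover have "G t * (1 + b * inverse (G t)) = G t + b" using nz by (simp add: field_simps)
    ultimately show ?case by simp
  qed
  show ?thesis
  proof
    assume "((\<lambda>t. Arg (G t + b)) \<longlongrightarrow> l) A"
    then have "((\<lambda>t. Arg (G t) + Arg (1 + b * inverse (G t))) \<longlongrightarrow> l) A"
      using filterlim_cong[OF refl refl ev] by blast
    from tendsto_diff[OF this lim] show "((\<lambda>t. Arg (G t)) \<longlongrightarrow> l) A" by simp
  next
    assume "((\<lambda>t. Arg (G t)) \<longlongrightarrow> l) A"
    from tendsto_add[OF this lim] have "((\<lambda>t. Arg (G t) + Arg (1 + b * inverse (G t))) \<longlongrightarrow> l) A"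
      by simp
    then show "((\<lambda>t. Arg (G t + b)) \<longlongrightarrow> l) A"
      using filterlim_cong[OF refl refl ev] by blast
  qed
qed

lemma Re_one_minus_pos:
  assumes "cmod \<tau> = 1" "cmod z < 1"
  shows "0 < Re (1 - cnj \<tau> * z)"
proof -
  have "Re (cnj \<tau> * z) \<le> cmod (cnj \<tau> * z)" by (rule complex_Re_le_cmod)
  then show ?thesis using assms by (simp add: norm_mult)
qed

text \<open>Cayley-type charts between the half-plane and the disc sending \<open>\<infinity>\<close> to \<open>\<tau>\<close>.\<close>
locale disc_chart =
  fixes \<tau> :: complex and x0 y0 :: real
  assumes \<tau>: "cmod \<tau> = 1" and x0: "0 < x0"
begin

text \<open>The inverse of \<open>1 - cnj \<tau> * z\<close> maps the disc onto
  \<open>Re > 1 / 2\<close>, which is then moved to the half-plane. The freedom in \<open>x0\<close>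
  and \<open>y0\<close> lets \<open>to_disc 1\<close> be any prescribed point of the disc.\<close>

definition to_disc :: "complex \<Rightarrow> complex" where
  "to_disc u = \<tau> * (1 - inverse (of_real x0 * u + \<i> * of_real y0 + 1 / 2))"

definition from_disc :: "complex \<Rightarrow> complex" where
  "from_disc z = (inverse (1 - cnj \<tau> * z) - (\<i> * of_real y0 + 1 / 2)) / of_real x0"

lemma cnj_\<tau>: "cnj \<tau> * \<tau> = 1" "\<tau> * cnj \<tau> = 1"
  using \<tau> complex_norm_square[of \<tau>] by (simp_all add: mult.commute)

lemma to_disc_in: "0 < Re u \<Longrightarrow> cmod (to_disc u) < 1"
proof -
  assume u: "0 < Re u"
  define v where "v = of_real x0 * u + \<i> * of_real y0 + 1 / 2"
  have v: "1 / 2 < Re v" using u x0 by (simp add: v_def)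
  then have nz: "v \<noteq> 0" by auto
  have "(cmod (v - 1))\<^sup>2 < (cmod v)\<^sup>2" using v unfolding cmod_power2 by (simp add: power2_eq_square algebra_simps)
  then have "cmod (v - 1) < cmod v" by (rule power2_less_imp_less) simp
  moreover have "1 - inverse v = (v - 1) / v" using nz by (simp add: field_simps)
  ultimately have "cmod (1 - inverse v) < 1" using nz by (simp add: norm_divide)
  then show ?thesis using \<tau> by (simp add: to_disc_def norm_mult flip: v_def)
qed

lemma from_disc_Re: "cmod z < 1 \<Longrightarrow> 0 < Re (from_disc z)"
proof -
  assume z: "cmod z < 1"
  define v where "v = 1 - cnj \<tau> * z"
  have v: "0 < Re v" using Re_one_minus_pos[OF \<tau> z] by (simp add: v_def)
  then have nz: "v \<noteq> 0" by auto
  have "cmod (1 - v) < 1" using z \<tau> by (simp add: v_def norm_mult)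
  then have "(cmod (1 - v))\<^sup>2 < 1" by (simp add: abs_square_less_1)
  then have "(cmod v)\<^sup>2 < 2 * Re v" unfolding cmod_power2 by (simp add: power2_eq_square algebra_simps)
  then have "1 / 2 < Re v / (cmod v)\<^sup>2" using nz by (simp add: field_simps)
  then have "1 / 2 < Re (inverse v)" by (simp add: cmod_power2)
  then show ?thesis using x0 by (simp add: from_disc_def flip: v_def)
qed

lemma to_from_disc: "cmod z < 1 \<Longrightarrow> to_disc (from_disc z) = z"
proof -
  assume z: "cmod z < 1"
  have "to_disc (from_disc z) = \<tau> * (cnj \<tau> * z)"
    using x0 by (simp add: to_disc_def from_disc_def)
  then show ?thesis using cnj_\<tau> by (simp flip: mult.assoc)
qed

lemma from_to_disc: "from_disc (to_disc u) = u"
proof -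
  have "cnj \<tau> * to_disc u = 1 - inverse (of_real x0 * u + \<i> * of_real y0 + 1 / 2)"
    unfolding to_disc_def using cnj_\<tau> by (simp flip: mult.assoc)
  then show ?thesis using x0 by (simp add: from_disc_def)
qed

lemma inverse_one_minus:
  "inverse (1 - cnj \<tau> * z) = of_real x0 * (from_disc z + (\<i> * of_real y0 + 1 / 2) / of_real x0)"
  using x0 by (simp add: from_disc_def flip: add_divide_distrib)

lemma to_disc_holo: "to_disc holomorphic_on right_halfplane"
proof -
  have "of_real x0 * u + \<i> * of_real y0 + 1 / 2 \<noteq> 0" if "u \<in> right_halfplane" for u
  proof -
    have "0 < Re (of_real x0 * u + \<i> * of_real y0 + 1 / 2)" using that x0 by (simp add: add_pos_pos)
    then show ?thesis by fastforce
  qed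
  then show ?thesis unfolding to_disc_def by (intro holomorphic_intros) auto
qed

lemma from_disc_holo: "from_disc holomorphic_on ball 0 1"
proof -
  have "1 - cnj \<tau> * z \<noteq> 0" if "z \<in> ball 0 1" for z
    using Re_one_minus_pos[OF \<tau>, of z] that by fastforce
  then show ?thesis unfolding from_disc_def using x0 by (intro holomorphic_intros) auto
qed

lemma from_disc_at_infinity:
  assumes "(g \<longlongrightarrow> \<tau>) A" "\<forall>\<^sub>F t in A. cmod (g t) < 1"
  shows "filterlim (\<lambda>t. from_disc (g t)) at_infinity A"
proof -
  have "((\<lambda>t. 1 - cnj \<tau> * g t) \<longlongrightarrow> 1 - cnj \<tau> * \<tau>) A" by (intro tendsto_intros assms)
  then have "((\<lambda>t. 1 - cnj \<tau> * g t) \<longlongrightarrow> 0) A" using cnj_\<tau> by simp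
  moreover have "\<forall>\<^sub>F t in A. 1 - cnj \<tau> * g t \<noteq> 0"
    using assms(2) by (rule eventually_mono) (use Re_one_minus_pos[OF \<tau>] in fastforce)
  ultimately have "filterlim (\<lambda>t. 1 - cnj \<tau> * g t) (at 0) A" by (simp add: filterlim_at)
  then have inf: "filterlim (\<lambda>t. inverse (1 - cnj \<tau> * g t)) at_infinity A"
    by (rule filterlim_compose[OF filterlim_inverse_at_infinity])
  define b where "b = (- (\<i> * of_real y0 + 1 / 2)) / (of_real x0 :: complex)"
  have "filterlim (\<lambda>t. inverse (of_real x0) * inverse (1 - cnj \<tau> * g t)) at_infinity A"
    using x0 by (intro tendsto_mult_filterlim_at_infinity[OF tendsto_const _ inf]) auto
  then have "filterlim (\<lambda>t. b + inverse (of_real x0) * inverse (1 - cnj \<tau> * g t)) at_infinity A"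
    by (rule tendsto_add_filterlim_at_infinity[OF tendsto_const])
  moreover have "from_disc (g t) = b + inverse (of_real x0) * inverse (1 - cnj \<tau> * g t)" for t
  proof -
    have "(I - c) / X = - c / X + inverse X * I" for I c X :: complex
      by (simp add: divide_inverse algebra_simps)
    then show ?thesis unfolding from_disc_def b_def .
  qed
  ultimately show ?thesis by simp
qed

end

section \<open>The semigroup and its Koenigs function in the half-plane\<close>

locale koenigs_chart = disc_chart +
  fixes \<phi> :: "real \<Rightarrow> complex \<Rightarrow> complex" and h :: "complex \<Rightarrow> complex"
  assumes DW: "nonelliptic_with_DW_point \<phi> \<tau>" and koenigs: "koenigs_function \<phi> h"
begin

abbreviation f :: "complex \<Rightarrow> complex" where
  "f \<equiv> h \<circ> to_disc"

lemma phi_holo: "0 \<le> t \<Longrightarrow> \<phi> t holomorphic_on ball 0 1"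
  and phi_in: "0 \<le> t \<Longrightarrow> cmod z < 1 \<Longrightarrow> cmod (\<phi> t z) < 1"
  and phi_0: "cmod z < 1 \<Longrightarrow> \<phi> 0 z = z"
  and phi_add: "0 \<le> s \<Longrightarrow> 0 \<le> t \<Longrightarrow> cmod z < 1 \<Longrightarrow> \<phi> (t + s) z = \<phi> t (\<phi> s z)"
  using DW by (auto simp: nonelliptic_with_DW_point_def disc_semigroup_def image_subset_iff)

lemma phi_tendsto_DW:
  assumes "cmod z < 1"
  shows "((\<lambda>t. \<phi> t z) \<longlongrightarrow> \<tau>) at_top"
proof -
  have "\<forall>K. compact K \<and> K \<subseteq> ball 0 1 \<longrightarrow> uniform_limit K \<phi> (\<lambda>_. \<tau>) at_top"
    using DW by (simp add: nonelliptic_with_DW_point_def)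
  from spec[OF this, of "{z}"] show ?thesis using assms by simp
qed

lemma phi_tendsto_0:
  assumes "cmod z < 1"
  shows "((\<lambda>t. \<phi> t z) \<longlongrightarrow> z) (at_right 0)"
proof -
  have "\<forall>K t\<^sub>0. compact K \<and> K \<subseteq> ball 0 1 \<and> t\<^sub>0 \<ge> 0 \<longrightarrow>
      uniform_limit K \<phi> (\<phi> t\<^sub>0) (at t\<^sub>0 within {0..})"
    using DW by (simp add: nonelliptic_with_DW_point_def disc_semigroup_def)
  from spec[OF spec[OF this, of "{z}"], of 0]
  have "((\<lambda>t. \<phi> t z) \<longlongrightarrow> z) (at 0 within {0..})" using assms phi_0 by simp
  then show ?thesis by (rule tendsto_within_subset) auto
qed

lemma h_holo: "h holomorphic_on ball 0 1" and h_inj: "inj_on h (ball 0 1)"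
  and h_phi: "0 \<le> t \<Longrightarrow> cmod z < 1 \<Longrightarrow> h (\<phi> t z) = h z + \<i> * of_real t"
  using koenigs by (auto simp: koenigs_function_def)

definition \<psi> :: "real \<Rightarrow> complex \<Rightarrow> complex" where
  "\<psi> t u = from_disc (\<phi> t (to_disc u))"

lemma \<psi>_Re: "0 \<le> t \<Longrightarrow> 0 < Re u \<Longrightarrow> 0 < Re (\<psi> t u)"
  unfolding \<psi>_def by (intro from_disc_Re phi_in to_disc_in)

lemma f_\<psi>: "0 \<le> t \<Longrightarrow> 0 < Re u \<Longrightarrow> f (\<psi> t u) = f u + \<i> * of_real t"
  using to_from_disc phi_in to_disc_in h_phi by (simp add: \<psi>_def)

text \<open>Julia's lemma for \<open>\<psi> t\<close> along its own orbit through \<open>u\<close>,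
  which tends to infinity by the Denjoy-Wolff property. For \<open>t = 0\<close> that orbit is
  constant, hence the separate case.\<close>

lemma Re_\<psi>_mono:
  assumes t: "0 \<le> t" and u: "0 < Re u"
  shows "Re u \<le> Re (\<psi> t u)"
proof (cases "t = 0")
  case True
  then show ?thesis using u by (simp add: \<psi>_def phi_0 to_disc_in from_to_disc)
next
  case False
  define a where "a = (\<lambda>n. \<psi> (real n * t) u)"
  show ?thesis
  proof (rule julia_halfplane)
    have "to_disc ` right_halfplane \<subseteq> ball 0 1" using to_disc_in by auto
    then have "(\<phi> t \<circ> to_disc) holomorphic_on right_halfplane"
      by (rule holomorphic_on_compose_gen[OF to_disc_holo phi_holo[OF t]])
    moreover have "(\<phi> t \<circ> to_disc) ` right_halfplane \<subseteq> ball 0 1"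
      using to_disc_in phi_in[OF t] by auto
    ultimately have "(from_disc \<circ> (\<phi> t \<circ> to_disc)) holomorphic_on right_halfplane"
      by (rule holomorphic_on_compose_gen[OF _ from_disc_holo])
    then show "\<psi> t holomorphic_on right_halfplane" by (simp add: \<psi>_def[abs_def] o_def)
    show "0 < Re (\<psi> t z)" if "0 < Re z" for z using \<psi>_Re t that .
    show "0 < Re (a n)" for n using t u by (auto simp: a_def intro: \<psi>_Re)
    show "a (Suc n) = \<psi> t (a n)" for n
    proof -
      have "\<phi> (t + real n * t) (to_disc u) = \<phi> t (\<phi> (real n * t) (to_disc u))"
        using t u by (intro phi_add to_disc_in) auto
      moreover have "real (Suc n) * t = t + real n * t" by (simp add: algebra_simps)
      ultimately show ?thesis
        unfolding a_def \<psi>_def using t u by (simp only: to_from_disc phi_in to_disc_in mult_nonneg_nonneg of_nat_0_le_iff)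
    qed
    have "filterlim (\<lambda>n. real n * t) at_top sequentially"
      using t False by (intro filterlim_at_top_mult_tendsto_pos[OF tendsto_const _ filterlim_real_sequentially]) auto
    then have "(\<lambda>n. \<phi> (real n * t) (to_disc u)) \<longlonglongrightarrow> \<tau>"
      by (rule filterlim_compose[OF phi_tendsto_DW[OF to_disc_in[OF u]]])
    then show "filterlim a at_infinity sequentially"
      unfolding a_def \<psi>_def using t u
      by (intro from_disc_at_infinity) (auto intro!: always_eventually phi_in to_disc_in)
    show "0 < Re u" by fact
  qed
qed

lemma f_holo: "f holomorphic_on right_halfplane"
  using to_disc_in by (intro holomorphic_on_compose_gen[OF to_disc_holo h_holo]) auto

lemma f_inj: "inj_on f right_halfplane"
proof (rule inj_onI)
  fix u v assume "u \<in> right_halfplane" "v \<in> right_halfplane" "f u = f v"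
  then have "to_disc u = to_disc v" using to_disc_in by (intro inj_onD[OF h_inj, of "to_disc u" "to_disc v"]) auto
  then show "u = v" using from_to_disc by metis
qed

text \<open>The derivative is a limit of difference quotients along the orbit as \<open>t\<close>
  decreases to \<open>0\<close>. Their numerators are \<open>\<i> * t\<close>, and their
  denominators have nonnegative real part by \<open>Re_\<psi>_mono\<close>.\<close>

lemma Im_deriv_f:
  assumes u: "0 < Re u"
  shows "0 \<le> Im (deriv f u)"
proof -
  have "(f has_field_derivative deriv f u) (at u)"
    using f_holo open_right_halfplane u by (intro holomorphic_derivI) auto
  then have lim: "((\<lambda>v. (f v - f u) / (v - u)) \<longlongrightarrow> deriv f u) (at u)"
    by (simp add: has_field_derivative_iff)
  have "isCont from_disc (to_disc u)"
    using from_disc_holo to_disc_in[OF u]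
    by (metis continuous_on_eq_continuous_at holomorphic_on_imp_continuous_on mem_ball_0 open_ball)
  then have "((\<lambda>t. \<psi> t u) \<longlongrightarrow> from_disc (to_disc u)) (at_right 0)"
    unfolding \<psi>_def by (rule isCont_tendsto_compose[OF _ phi_tendsto_0[OF to_disc_in[OF u]]])
  moreover have ne: "\<psi> t u \<noteq> u" if "0 < t" for t
    using f_\<psi>[of t u] that u by auto
  ultimately have "filterlim (\<lambda>t. \<psi> t u) (at u) (at_right 0)"
    by (auto simp: filterlim_at from_to_disc eventually_at_right_less intro: eventually_mono[OF eventually_at_right_less])
  from filterlim_compose[OF lim this]
  have "((\<lambda>t. Im ((f (\<psi> t u) - f u) / (\<psi> t u - u))) \<longlongrightarrow> Im (deriv f u)) (at_right 0)"
    by (rule tendsto_Im)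
  moreover have "\<forall>\<^sub>F t in at_right 0. 0 \<le> Im ((f (\<psi> t u) - f u) / (\<psi> t u - u))"
    using eventually_at_right_less[of 0]
  proof eventually_elim
    case (elim t)
    have "0 \<le> t * Re (\<psi> t u - u)" using Re_\<psi>_mono[of t u] elim u by simp
    then have "0 \<le> Im ((f (\<psi> t u) - f u) * cnj (\<psi> t u - u))"
      using elim u f_\<psi>[of t u] by simp
    then show ?case by (simp only: Im_complex_div_ge_0)
  qed
  ultimately show ?thesis by (rule tendsto_lowerbound) simp
qed

sublocale upward_map f
proof
  show "f holomorphic_on right_halfplane" by (rule f_holo)
  show "inj_on f right_halfplane" by (rule f_inj)
  show "0 \<le> Im (deriv f z)" if "0 < Re z" for z using Im_deriv_f[OF that] .
  show "f z + \<i> * of_real t \<in> f ` right_halfplane" if "0 < Re z" "0 \<le> t" for z t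
    using f_\<psi>[OF that(2,1)] \<psi>_Re[OF that(2,1)] by (intro image_eqI[of _ _ "\<psi> t z"]) auto
qed

lemma Om_eq: "Om = h ` ball 0 1"
proof -
  have "to_disc ` right_halfplane = ball 0 1"
  proof
    show "ball 0 1 \<subseteq> to_disc ` right_halfplane"
    proof
      fix z :: complex assume "z \<in> ball 0 1"
      then show "z \<in> to_disc ` right_halfplane"
        using from_disc_Re to_from_disc by (intro image_eqI[of _ _ "from_disc z"]) auto
    qed
  qed (use to_disc_in in auto)
  then show ?thesis by (metis image_comp)
qed

text \<open>\<open>1 - cnj \<tau> * \<phi> t z\<close> is the inverse of a positive multiple of the
  translated half-plane coordinate, which negates the argument; the translation does not affect the
  limit.\<close>

lemma Arg_phi_tendsto_iff:
  "((\<lambda>t. Arg (1 - cnj \<tau> * \<phi> t (to_disc 1))) \<longlongrightarrow> - l) at_top \<longleftrightarrow>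
   ((\<lambda>t. Arg (F (f 1 + \<i> * of_real t))) \<longlongrightarrow> l) at_top"
proof -
  define z where "z = to_disc 1"
  have z: "cmod z < 1" using to_disc_in by (simp add: z_def)
  define b where "b = (\<i> * of_real y0 + 1 / 2) / (of_real x0 :: complex)"
  have ev: "\<forall>\<^sub>F t in at_top. Arg (1 - cnj \<tau> * \<phi> t z) = - Arg (F (f 1 + \<i> * of_real t) + b)"
    using eventually_ge_at_top[of 0]
  proof eventually_elim
    case (elim t)
    define v where "v = 1 - cnj \<tau> * \<phi> t z"
    have F: "F (f 1 + \<i> * of_real t) = from_disc (\<phi> t z)"
      using F_f[OF \<psi>_Re[OF elim, of 1]] f_\<psi>[OF elim, of 1] by (simp add: \<psi>_def z_def)
    have v: "0 < Re v" using Re_one_minus_pos[OF \<tau> phi_in[OF elim z]] by (simp add: v_def)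
    have "Arg (inverse v) = - Arg v"
      using v by (auto simp: Arg_inverse complex_is_Real_iff arg_conv_arctan)
    moreover have "inverse v = of_real x0 * (F (f 1 + \<i> * of_real t) + b)"
      unfolding v_def F b_def by (rule inverse_one_minus)
    ultimately show ?case using x0 by (simp flip: v_def)
  qed
  have inf: "filterlim (\<lambda>t. F (f 1 + \<i> * of_real t)) at_infinity at_top"
  proof -
    have "filterlim (\<lambda>t. from_disc (\<phi> t z)) at_infinity at_top"
      using phi_in z by (intro from_disc_at_infinity phi_tendsto_DW)
        (auto intro: eventually_mono[OF eventually_ge_at_top[of 0]])
    moreover have ev: "\<forall>\<^sub>F t in at_top. from_disc (\<phi> t z) = F (f 1 + \<i> * of_real t)"
      using eventually_ge_at_top[of 0]
    proof eventually_elim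
      case (elim t)
      show ?case using F_f[OF \<psi>_Re[OF elim, of 1]] f_\<psi>[OF elim, of 1] by (simp add: \<psi>_def z_def)
    qed
    ultimately show ?thesis by (simp only: filterlim_cong[OF refl refl ev])
  qed
  have pos: "\<forall>\<^sub>F t in at_top. 0 < Re (F (f 1 + \<i> * of_real t))"
    using eventually_ge_at_top[of 0] by (rule eventually_mono) (intro Re_F orbit_in)
  have "((\<lambda>t. Arg (1 - cnj \<tau> * \<phi> t z)) \<longlongrightarrow> - l) at_top \<longleftrightarrow>
      ((\<lambda>t. - Arg (F (f 1 + \<i> * of_real t) + b)) \<longlongrightarrow> - l) at_top"
    by (rule filterlim_cong[OF refl refl ev])
  also have "\<dots> \<longleftrightarrow> ((\<lambda>t. Arg (F (f 1 + \<i> * of_real t) + b)) \<longlongrightarrow> l) at_top"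
    using tendsto_minus_cancel_left[of "\<lambda>t. - Arg (F (f 1 + \<i> * of_real t) + b)" l at_top] by simp
  also have "\<dots> \<longleftrightarrow> ((\<lambda>t. Arg (F (f 1 + \<i> * of_real t))) \<longlongrightarrow> l) at_top"
    by (rule Arg_add_const_tendsto_iff[OF inf pos])
  finally show ?thesis by (simp add: z_def)
qed

end

section \<open>Arbitrary base points and the final equivalences\<close>

context
  fixes \<phi> :: "real \<Rightarrow> complex \<Rightarrow> complex" and \<tau> :: complex
  assumes DW: "nonelliptic_with_DW_point \<phi> \<tau>"
begin

lemma norm_DW_point: "cmod \<tau> = 1"
  using DW by (simp add: nonelliptic_with_DW_point_def)

text \<open>The chart is adapted to \<open>z\<close> so that \<open>to_disc 1 = z\<close>; then
  \<open>f 1 = h z\<close> and the half-plane results speak about \<open>p = h z\<close>.\<close>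

lemma Arg_phi_tendsto_iff_delta:
  assumes h: "koenigs_function \<phi> h" and z: "z \<in> ball 0 1"
  shows "((\<lambda>t. Arg (1 - cnj \<tau> * \<phi> t z)) \<longlongrightarrow> pi / 2) at_top \<longleftrightarrow>
      ((\<lambda>t. delta_plus (h ` ball 0 1) (h z) t / delta_minus (h ` ball 0 1) (h z) t) \<longlongrightarrow> 0) at_top"
    and "((\<lambda>t. Arg (1 - cnj \<tau> * \<phi> t z)) \<longlongrightarrow> - pi / 2) at_top \<longleftrightarrow>
      filterlim (\<lambda>t. delta_plus (h ` ball 0 1) (h z) t / delta_minus (h ` ball 0 1) (h z) t) at_top at_top"
proof -
  define u where "u = inverse (1 - cnj \<tau> * z)"
  \<comment> \<open>This normalized chart yields \<open>1 / 2 < Re u\<close>, as the scale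
    \<open>Re u - 1 / 2\<close> must be positive.\<close>
  interpret c: disc_chart \<tau> 1 0 by unfold_locales (auto simp: norm_DW_point)
  have "0 < Re (c.from_disc z)" using z by (intro c.from_disc_Re) auto
  then have "0 < Re u - 1 / 2" by (simp add: c.from_disc_def u_def)
  then interpret k: koenigs_chart \<tau> "Re u - 1 / 2" "Im u" \<phi> h
    by unfold_locales (use norm_DW_point DW h in auto)
  have "of_real (Re u - 1 / 2) * 1 + \<i> * of_real (Im u) + 1 / 2 = u"
    by (simp add: complex_eq_iff)
  then have "k.to_disc 1 = \<tau> * (cnj \<tau> * z)"
    by (simp only: k.to_disc_def) (simp add: u_def)
  then have base: "k.to_disc 1 = z" using k.cnj_\<tau> by (simp flip: mult.assoc)
  show "((\<lambda>t. Arg (1 - cnj \<tau> * \<phi> t z)) \<longlongrightarrow> pi / 2) at_top \<longleftrightarrow>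
      ((\<lambda>t. delta_plus (h ` ball 0 1) (h z) t / delta_minus (h ` ball 0 1) (h z) t) \<longlongrightarrow> 0) at_top"
    using k.Arg_phi_tendsto_iff[of "- pi / 2"] k.Arg_orbit_tendsto_neg_iff base by (simp add: k.Om_eq[unfolded o_def])
  show "((\<lambda>t. Arg (1 - cnj \<tau> * \<phi> t z)) \<longlongrightarrow> - pi / 2) at_top \<longleftrightarrow>
      filterlim (\<lambda>t. delta_plus (h ` ball 0 1) (h z) t / delta_minus (h ` ball 0 1) (h z) t) at_top at_top"
    using k.Arg_phi_tendsto_iff[of "pi / 2"] k.Arg_orbit_tendsto_pos_iff base by (simp add: k.Om_eq[unfolded o_def])
qed

text \<open>Harnack's inequality for the positive harmonic function \<open>pi / 2 - s * Arg (1 - cnj \<tau> * \<phi> t z)\<close>.\<close>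
lemma Arg_phi_tendsto_any:
  assumes s: "s = 1 \<or> s = - 1" and z: "z \<in> ball 0 1" and z': "z' \<in> ball 0 1"
    and lim: "((\<lambda>t. Arg (1 - cnj \<tau> * \<phi> t z)) \<longlongrightarrow> s * pi / 2) at_top"
  shows "((\<lambda>t. Arg (1 - cnj \<tau> * \<phi> t z')) \<longlongrightarrow> s * pi / 2) at_top"
proof -
  define W where "W = (\<lambda>t u. of_real (pi / 2) + \<i> * of_real s * Ln (1 - cnj \<tau> * \<phi> t u))"
  \<comment> \<open>The Harnack constants for comparing \<open>z'\<close> with \<open>0\<close> and
    \<open>0\<close> with \<open>z\<close>.\<close>
  define K where "K = (1 + cmod z') / (1 - cmod z') * ((1 + cmod z) / (1 - cmod z))"
  have Re_pos: "0 < Re (1 - cnj \<tau> * \<phi> t u)" if "0 \<le> t" "u \<in> ball 0 1" for t u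
    using DW that by (intro Re_one_minus_pos norm_DW_point)
      (auto simp: nonelliptic_with_DW_point_def disc_semigroup_def image_subset_iff)
  have Re_W: "Re (W t u) = pi / 2 - s * Arg (1 - cnj \<tau> * \<phi> t u)"
    and W_pos: "0 < Re (W t u)" if "0 \<le> t" "u \<in> ball 0 1" for t u
  proof -
    have nz: "1 - cnj \<tau> * \<phi> t u \<noteq> 0" using Re_pos[OF that] by fastforce
    then show eq: "Re (W t u) = pi / 2 - s * Arg (1 - cnj \<tau> * \<phi> t u)"
      by (simp add: W_def Arg_eq_Im_Ln)
    have "\<bar>Arg (1 - cnj \<tau> * \<phi> t u)\<bar> < pi / 2" using Re_pos[OF that] Arg_Re_pos by blast
    then show "0 < Re (W t u)" unfolding eq using s by auto
  qed
  have harnack: "Re (W t z') \<le> K * Re (W t z)" if t: "0 \<le> t" for t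
  proof -
    have "\<phi> t holomorphic_on ball 0 1"
      using DW t by (simp add: nonelliptic_with_DW_point_def disc_semigroup_def)
    moreover have "1 - cnj \<tau> * \<phi> t u \<notin> \<real>\<^sub>\<le>\<^sub>0" if "u \<in> ball 0 1" for u
      using Re_pos[OF t that] unfolding complex_nonpos_Reals_iff by linarith
    ultimately have hol: "W t holomorphic_on ball 0 1"
      unfolding W_def by (intro holomorphic_intros) auto
    have sp: "cmod (W t u - W t 0) \<le> cmod u * cmod (W t u + cnj (W t 0))" if "u \<in> ball 0 1" for u
      using schwarz_pick_disc_halfplane[OF hol W_pos[OF t] that] .
    have "Re (W t z') \<le> (1 + cmod z') / (1 - cmod z') * Re (W t 0)"
      using z' W_pos t by (intro Re_le_of_pseudo_dist_le sp) auto
    moreover have "Re (W t 0) \<le> (1 + cmod z) / (1 - cmod z) * Re (W t z)"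
    proof (rule Re_le_of_pseudo_dist_le)
      have "cmod (W t z + cnj (W t 0)) = cmod (cnj (W t z + cnj (W t 0)))" by (rule complex_mod_cnj[symmetric])
      also have "cnj (W t z + cnj (W t 0)) = W t 0 + cnj (W t z)" by simp
      finally show "cmod (W t 0 - W t z) \<le> cmod z * cmod (W t 0 + cnj (W t z))"
        using sp[OF z] by (simp add: norm_minus_commute)
    qed (use z W_pos t in auto)
    moreover have "0 \<le> (1 + cmod z') / (1 - cmod z')" using z' by simp
    ultimately show ?thesis unfolding K_def mult.assoc by (meson mult_left_mono order_trans)
  qed
  have s2: "s * s = 1" using s by auto
  have lim_W: "((\<lambda>t. pi / 2 - s * Arg (1 - cnj \<tau> * \<phi> t z)) \<longlongrightarrow> pi / 2 - s * (s * pi / 2)) at_top"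
    by (intro tendsto_intros lim)
  have "((\<lambda>t. pi / 2 - s * Arg (1 - cnj \<tau> * \<phi> t z')) \<longlongrightarrow> 0) at_top"
  proof (rule tendsto_sandwich[of "\<lambda>_. 0"])
    show "\<forall>\<^sub>F t in at_top. 0 \<le> pi / 2 - s * Arg (1 - cnj \<tau> * \<phi> t z')"
      using eventually_ge_at_top[of 0] by (rule eventually_mono) (use Re_W W_pos z' in force)
    show "\<forall>\<^sub>F t in at_top. pi / 2 - s * Arg (1 - cnj \<tau> * \<phi> t z')
        \<le> K * (pi / 2 - s * Arg (1 - cnj \<tau> * \<phi> t z))"
      using eventually_ge_at_top[of 0] by (rule eventually_mono) (use Re_W harnack z z' in force)
    have "pi / 2 - s * (s * pi / 2) = 0" using s by auto
    from lim_W[unfolded this]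
    show "((\<lambda>t. K * (pi / 2 - s * Arg (1 - cnj \<tau> * \<phi> t z))) \<longlongrightarrow> 0) at_top"
      by (rule tendsto_mult_right_zero)
  qed simp
  then have "((\<lambda>t. s * (pi / 2) - s * (pi / 2 - s * Arg (1 - cnj \<tau> * \<phi> t z'))) \<longlongrightarrow> s * (pi / 2) - s * 0) at_top"
    by (intro tendsto_intros)
  moreover have "s * (pi / 2) - s * (pi / 2 - s * a) = a" for a
    using s2 by (simp add: right_diff_distrib mult.assoc[symmetric])
  ultimately show ?thesis by simp
qed

end

lemma cluster_set_at_top_eq:
  assumes "(g \<longlongrightarrow> l) at_top"
  shows "cluster_set_at_top g = {l}"
proof -
  have "(\<lambda>n. g (real n)) \<longlonglongrightarrow> l"
    by (rule filterlim_compose[OF assms filterlim_real_sequentially])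
  moreover have "l' = l" if "filterlim s at_top sequentially" "(\<lambda>n. g (s n)) \<longlonglongrightarrow> l'" for s l'
    using that filterlim_compose[OF assms that(1)] LIMSEQ_unique by blast
  ultimately show ?thesis
    unfolding cluster_set_at_top_def using filterlim_real_sequentially by blast
qed

theorem theorem1p3:
  fixes \<phi> :: "real \<Rightarrow> complex \<Rightarrow> complex" and \<tau> :: complex
    and h :: "complex \<Rightarrow> complex" and \<Omega> :: "complex set"
  assumes "nonelliptic_with_DW_point \<phi> \<tau>"
    and "koenigs_function \<phi> h"
    and "\<Omega> = h ` ball 0 1"
  shows
    "((\<exists>z\<in>ball 0 1. ((\<lambda>t. Arg (1 - cnj \<tau> * \<phi> t z)) \<longlongrightarrow> pi / 2) at_top) \<longleftrightarrow>
      (\<forall>z\<in>ball 0 1. ((\<lambda>t. Arg (1 - cnj \<tau> * \<phi> t z)) \<longlongrightarrow> pi / 2) at_top)) \<and>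
     ((\<exists>p\<in>\<Omega>. ((\<lambda>t. delta_plus \<Omega> p t / delta_minus \<Omega> p t) \<longlongrightarrow> 0) at_top) \<longleftrightarrow>
      (\<forall>p\<in>\<Omega>. ((\<lambda>t. delta_plus \<Omega> p t / delta_minus \<Omega> p t) \<longlongrightarrow> 0) at_top)) \<and>
     ((\<exists>z\<in>ball 0 1. ((\<lambda>t. Arg (1 - cnj \<tau> * \<phi> t z)) \<longlongrightarrow> pi / 2) at_top) \<longleftrightarrow>
      (\<exists>p\<in>\<Omega>. ((\<lambda>t. delta_plus \<Omega> p t / delta_minus \<Omega> p t) \<longlongrightarrow> 0) at_top)) \<and>
     ((\<exists>z\<in>ball 0 1. ((\<lambda>t. Arg (1 - cnj \<tau> * \<phi> t z)) \<longlongrightarrow> - pi / 2) at_top) \<longleftrightarrow>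
      (\<forall>z\<in>ball 0 1. ((\<lambda>t. Arg (1 - cnj \<tau> * \<phi> t z)) \<longlongrightarrow> - pi / 2) at_top)) \<and>
     ((\<exists>p\<in>\<Omega>. filterlim (\<lambda>t. delta_plus \<Omega> p t / delta_minus \<Omega> p t) at_top at_top) \<longleftrightarrow>
      (\<forall>p\<in>\<Omega>. filterlim (\<lambda>t. delta_plus \<Omega> p t / delta_minus \<Omega> p t) at_top at_top)) \<and>
     ((\<exists>z\<in>ball 0 1. ((\<lambda>t. Arg (1 - cnj \<tau> * \<phi> t z)) \<longlongrightarrow> - pi / 2) at_top) \<longleftrightarrow>
      (\<exists>p\<in>\<Omega>. filterlim (\<lambda>t. delta_plus \<Omega> p t / delta_minus \<Omega> p t) at_top at_top)) \<and>
     (\<forall>z\<in>ball 0 1.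
       (((\<lambda>t. Arg (1 - cnj \<tau> * \<phi> t z)) \<longlongrightarrow> pi / 2) at_top \<or>
        ((\<lambda>t. Arg (1 - cnj \<tau> * \<phi> t z)) \<longlongrightarrow> - pi / 2) at_top) \<longrightarrow>
       orbit_converges_tangentially \<phi> \<tau> z)"
proof -
  define P where "P = (\<lambda>z. ((\<lambda>t. Arg (1 - cnj \<tau> * \<phi> t z)) \<longlongrightarrow> pi / 2) at_top)"
  define M where "M = (\<lambda>z. ((\<lambda>t. Arg (1 - cnj \<tau> * \<phi> t z)) \<longlongrightarrow> - pi / 2) at_top)"
  define Z where "Z = (\<lambda>p. ((\<lambda>t. delta_plus \<Omega> p t / delta_minus \<Omega> p t) \<longlongrightarrow> 0) at_top)"
  define I where "I = (\<lambda>p. filterlim (\<lambda>t. delta_plus \<Omega> p t / delta_minus \<Omega> p t) at_top at_top)"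
  \<comment> \<open>Every \<open>p\<close> in \<open>\<Omega>\<close> is some \<open>h z\<close>, so
    independence of the point, shown for the argument condition, carries over to the ratio.\<close>
  have PZ: "P z \<longleftrightarrow> Z (h z)" and MI: "M z \<longleftrightarrow> I (h z)" if "z \<in> ball 0 1" for z
    unfolding P_def M_def Z_def I_def assms(3)
    by (rule Arg_phi_tendsto_iff_delta[OF assms(1,2) that])+
  have P_any: "P z'" if "z \<in> ball 0 1" "z' \<in> ball 0 1" "P z" for z z'
    using Arg_phi_tendsto_any[OF assms(1) _ that(1,2), of 1] that(3) by (simp add: P_def)
  have M_any: "M z'" if "z \<in> ball 0 1" "z' \<in> ball 0 1" "M z" for z z'
    using Arg_phi_tendsto_any[OF assms(1) _ that(1,2), of "- 1"] that(3) by (simp add: M_def)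
  have tangential: "orbit_converges_tangentially \<phi> \<tau> z" if "P z \<or> M z" for z
    using that cluster_set_at_top_eq unfolding P_def M_def orbit_converges_tangentially_def by blast
  have ball_ne: "\<exists>z. z \<in> ball (0 :: complex) 1" by (intro exI[of _ 0]) simp
  have "((\<exists>z\<in>ball 0 1. P z) \<longleftrightarrow> (\<forall>z\<in>ball 0 1. P z)) \<and>
     ((\<exists>p\<in>\<Omega>. Z p) \<longleftrightarrow> (\<forall>p\<in>\<Omega>. Z p)) \<and>
     ((\<exists>z\<in>ball 0 1. P z) \<longleftrightarrow> (\<exists>p\<in>\<Omega>. Z p)) \<and>
     ((\<exists>z\<in>ball 0 1. M z) \<longleftrightarrow> (\<forall>z\<in>ball 0 1. M z)) \<and>
     ((\<exists>p\<in>\<Omega>. I p) \<longleftrightarrow> (\<forall>p\<in>\<Omega>. I p)) \<and>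
     ((\<exists>z\<in>ball 0 1. M z) \<longleftrightarrow> (\<exists>p\<in>\<Omega>. I p)) \<and>
     (\<forall>z\<in>ball 0 1. P z \<or> M z \<longrightarrow> orbit_converges_tangentially \<phi> \<tau> z)"
    unfolding assms(3) ball_simps(9) bex_simps(7)
    using PZ MI P_any M_any tangential ball_ne by (smt (verit))
  then show ?thesis unfolding P_def M_def Z_def I_def .
qed

end
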